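(* Let $(\alpha,\beta)$ be an interval whose endpoints $\alpha$ and $\beta$ are irrational numbers that are linearly independent over $\mathbb{Q}$. For each $n$ equip $\mathfrak{S}_n$ with the uniform probability measure (the Ewens distribution with parameter $\theta=1$), let $$Y_{n,2}=\sum_{j=1}^n \frac{j\,C_j^{(n)}\,(\{j\alpha\}-\{j\beta\})}{n},$$ and let $Y_{\infty,2}$ be the weak limit of $Y_{n,2}$ as $n\to\infty$. Then $Y_{\infty,2}$ is supported on the interval $[-1,1]$ and has probability density $$p_{Y_{\infty,2}}(t)=\frac{e^{3/2}}{\pi|t|}\left(\frac{1}{|t|}-1\right)^{-\frac12(1-|t|)^2}\left(\frac{1}{|t|}+1\right)^{-\frac12(1+|t|)^2}\sin\!\left(\frac{(1-|t|)^2}{2}\pi\right)$$ for $-1\le t\le 1$ (and, by continuity, $p_{Y_{\infty,2}}(0)=e^{3/2}/\pi$).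
   Context: $\{x\}$ is the fractional part of $x$. $\mathfrak{S}_n$ is the symmetric group on $\{1,\dots,n\}$ and $C_j^{(n)}(\sigma)$ is the number of cycles of length $j$ of $\sigma\in\mathfrak{S}_n$. The existence of the compactly supported weak limit $Y_{\infty,2}$ is a separate theorem of the same paper.
   Formalization: Linear independence over the rationals is required of 1, α, β rather than only of α, β; otherwise the claim fails, e.g. for α = √2−1, β = 2−√2, where {jα}−{jβ} = 2{jα}−1 is uniformly distributed on [−1,1]. *)

theory Defs
  imports "HOL-Probability.Probability" "HOL-Combinatorics.Orbits"
begin

definition cycle_count :: "nat \<Rightarrow> nat \<Rightarrow> (nat \<Rightarrow> nat) \<Rightarrow> nat" where
  "cycle_count n j \<sigma> = card {S. S \<subseteq> {1..n} \<and> cyclic_on \<sigma> S \<and> card S = j}"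

definition uniform_perm :: "nat \<Rightarrow> (nat \<Rightarrow> nat) pmf" where
  "uniform_perm n = pmf_of_set {\<sigma>. \<sigma> permutes {1..n}}"

definition Y2 :: "real \<Rightarrow> real \<Rightarrow> nat \<Rightarrow> (nat \<Rightarrow> nat) \<Rightarrow> real" where
  "Y2 \<alpha> \<beta> n \<sigma> =
     (\<Sum>j=1..n. real j * real (cycle_count n j \<sigma>) * (frac (real j * \<alpha>) - frac (real j * \<beta>)) / real n)"

text \<open>
  At \<open>t = 1\<close> and \<open>t = -1\<close> the first power has base and exponent 0, where \<open>0 powr 0 = 0\<close>
  instead of 1. This is harmless, because the sine factor vanishes there.
\<close>

definition Y2_limit_density :: "real \<Rightarrow> real" where
  "Y2_limit_density t =
     (if \<bar>t\<bar> > 1 then 0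
      else if t = 0 then exp (3/2) / pi
      else exp (3/2) / (pi * \<bar>t\<bar>)
           * (1 / \<bar>t\<bar> - 1) powr (- (1/2) * (1 - \<bar>t\<bar>)\<^sup>2)
           * (1 / \<bar>t\<bar> + 1) powr (- (1/2) * (1 + \<bar>t\<bar>)\<^sup>2)
           * sin ((1 - \<bar>t\<bar>)\<^sup>2 / 2 * pi))"

text \<open>
  Linear independence over the rationals, with the reals as a rational vector space. For
  irrational endpoints \<open>\<alpha>\<close> and \<open>\<beta>\<close> it is required of \<open>1\<close>, \<open>\<alpha>\<close>, \<open>\<beta>\<close> together, as in
  Kronecker's theorem: independence of \<open>\<alpha>\<close> and \<open>\<beta>\<close> alone allows \<open>\<alpha> = sqrt 2 - 1\<close>,
  \<open>\<beta> = 2 - sqrt 2\<close>, where \<open>frac (j * \<alpha>)\<close> and \<open>frac (j * \<beta>)\<close> sum to 1 for every \<open>j \<ge> 1\<close> and the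
  limit law is a different one.
\<close>

abbreviation rat_independent :: "real set \<Rightarrow> bool" where
  "rat_independent S \<equiv> module.independent (\<lambda>(q :: rat) x. of_rat q * x) S"

end

theory Submission
  imports Defs "HOL-Complex_Analysis.Complex_Analysis"
begin

text \<open>
  Write \<open>u j = frac (j * \<alpha>) - frac (j * \<beta>)\<close>. A cycle of length \<open>j\<close> contains \<open>j\<close> points, so
  \<open>n * Y\<^sub>n\<close> is the sum of \<open>u\<close> at the cycle length of \<open>e\<close> over all points \<open>e\<close>. All the laws
  involved live on \<open>[-1, 1]\<close>. For such laws convergence of all moments implies convergence of the
  characteristic functions (\<open>char_tendsto_if_moments_tendsto\<close>), so the weak limit is known as
  soon as the limits of the moments are identified with the moments of the density.

  \<^emph>\<open>The moments of \<open>Y\<^sub>n\<close>.\<close> In a uniform permutation the cycle through a given point has uniformly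
  distributed length, and what remains after its removal is again a uniform permutation. Writing one
  factor of the \<open>(k+1)\<close>-st power of \<open>n * Y\<^sub>n\<close> as a sum over points and splitting off the cycle
  of that point expresses the \<open>(k+1)\<close>-st moment by lower ones (\<open>sum_perms_orbit_sum_power\<close>). The
  values \<open>u j\<close> enter asymptotically only through the Cesaro means of their powers, because the
  weights \<open>j ^ i * (n - j) ^ p\<close> vary slowly (\<open>weighted_convolution\<close>). By equidistribution of the
  points \<open>(j * \<alpha>, j * \<beta>)\<close> on the torus these means are the moments \<open>\<mu> i\<close> of the difference of two
  independent uniform variables, which has the triangular density \<open>1 - \<bar>x\<bar>\<close>
  (\<open>has_mean_frac_difference_power\<close>). A Beta integral cancels the binomial coefficients, and the
  limits \<open>m k\<close> satisfy \<open>(k + 1) * m (k + 1) = (\<Sum>i\<le>k. \<mu> (i + 1) * m (k - i))\<close>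
  (\<open>orbit_sum_moment_tendsto\<close>). Equivalently, the generating function of \<open>m\<close> is the exponential of
  the series with coefficients \<open>\<mu> i / i\<close>.

  \<^emph>\<open>The moments of the density.\<close> With \<open>z = 1 / w\<close> this generating function is \<open>w * G w\<close>, where
  \<open>G w\<close> is the exponential of minus the integral of \<open>log (w - x) * (1 - \<bar>x\<bar>)\<close> over \<open>[-1, 1]\<close>. The
  triangular density is the second difference of a kink, hence \<open>log G\<close> is elementary:
  up to a factor and a constant it is a second difference of \<open>w\<^sup>2 * log w\<close> (\<open>stieltjes\<close>). On the upper half
  plane \<open>G\<close> is holomorphic with continuous boundary values, and on the real line the imaginary
  part of \<open>G\<close> is \<open>- pi\<close> times the density (\<open>Y2_limit_density_eq\<close>). Cauchy's theorem on large half
  discs for \<open>w ^ k * G w\<close> then shows that the \<open>k\<close>-th moment of the density is the coefficient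
  \<open>m k\<close> of \<open>w\<close> to the power \<open>- k - 1\<close> in the expansion of \<open>G\<close> at infinity
  (\<open>has_integral_limit_moment\<close>).
\<close>

section \<open>Splitting off a cycle of a random permutation\<close>

abbreviation perms_with_orbit :: "'a set \<Rightarrow> 'a \<Rightarrow> 'a set \<Rightarrow> ('a \<Rightarrow> 'a) set" where
  "perms_with_orbit A a C \<equiv> {\<sigma>. \<sigma> permutes A \<and> orbit \<sigma> a = C}"

lemma self_in_orbit_permutes:
  assumes "\<sigma> permutes A" "finite A"
  shows "e \<in> orbit \<sigma> e"
  by (meson assms permutation_permutes permutation_self_in_orbit)

lemma orbit_comp_left:
  assumes "\<rho> permutes C" "\<tau> permutes B" "C \<inter> B = {}" "e \<in> C"
  shows "orbit (\<rho> \<circ> \<tau>) e = orbit \<rho> e"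
proof (rule orbit_cong0[OF assms(4)])
  have "\<tau> x = x" if "x \<in> C" for x
    using assms that by (metis IntI empty_iff permutes_not_in)
  then show "\<rho> \<circ> \<tau> \<in> C \<rightarrow> C" "\<And>y. y \<in> C \<Longrightarrow> (\<rho> \<circ> \<tau>) y = \<rho> y"
    using assms(1) by (auto simp: permutes_in_image)
qed

lemma orbit_comp_right:
  assumes "\<rho> permutes C" "\<tau> permutes B" "C \<inter> B = {}" "e \<in> B"
  shows "orbit (\<rho> \<circ> \<tau>) e = orbit \<tau> e"
proof (rule orbit_cong0[OF assms(4)])
  have "\<rho> x = x" if "x \<in> B" for x
    using assms that by (metis IntI empty_iff permutes_not_in)
  then show "\<rho> \<circ> \<tau> \<in> B \<rightarrow> B" "\<And>y. y \<in> B \<Longrightarrow> (\<rho> \<circ> \<tau>) y = \<tau> y"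
    using assms(2) by (auto simp: permutes_in_image)
qed

text \<open>
  Removing the cycle \<open>C\<close> of \<open>a\<close> leaves an arbitrary permutation of \<open>A - C\<close>. The two
  restrictions of \<open>\<sigma>\<close> to \<open>C\<close> and \<open>A - C\<close> give the inverse map.
\<close>
lemma bij_betw_split_off_orbit:
  assumes "finite A" "a \<in> C" "C \<subseteq> A"
  shows "bij_betw (\<lambda>(\<rho>, \<tau>). \<rho> \<circ> \<tau>)
           (perms_with_orbit C a C \<times> {\<tau>. \<tau> permutes (A - C)}) (perms_with_orbit A a C)"
proof (rule bij_betwI[where g = "\<lambda>\<sigma>. (perm_restrict \<sigma> C, perm_restrict \<sigma> (A - C))"])
  have disj: "C \<inter> (A - C) = {}" by blast
  show "(\<lambda>(\<rho>, \<tau>). \<rho> \<circ> \<tau>) \<in> perms_with_orbit C a C \<times> {\<tau>. \<tau> permutes (A - C)} \<rightarrow> perms_with_orbit A a C"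
  proof (rule funcsetI)
    fix x assume "x \<in> perms_with_orbit C a C \<times> {\<tau>. \<tau> permutes (A - C)}"
    then obtain \<rho> \<tau> where x: "x = (\<rho>, \<tau>)"
      and h: "\<rho> permutes C" "orbit \<rho> a = C" "\<tau> permutes (A - C)" by blast
    have "\<rho> permutes A" using h assms by (metis permutes_subset)
    moreover have "\<tau> permutes A" using h(3) permutes_subset by blast
    ultimately have "\<rho> \<circ> \<tau> permutes A" using permutes_compose by blast
    moreover have "orbit (\<rho> \<circ> \<tau>) a = C"
      using orbit_comp_left[OF h(1) h(3) disj assms(2)] h(2) by simp
    ultimately show "(\<lambda>(\<rho>, \<tau>). \<rho> \<circ> \<tau>) x \<in> perms_with_orbit A a C" using x by simp
  qed
  show "(\<lambda>\<sigma>. (perm_restrict \<sigma> C, perm_restrict \<sigma> (A - C))) \<in>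
     perms_with_orbit A a C \<rightarrow> perms_with_orbit C a C \<times> {\<tau>. \<tau> permutes (A - C)}"
  proof (rule funcsetI)
    fix \<sigma> assume "\<sigma> \<in> perms_with_orbit A a C"
    then have s: "\<sigma> permutes A" "orbit \<sigma> a = C" by auto
    have cyc: "cyclic_on \<sigma> C" using cyclic_on_orbit[OF s(1) assms(1)] s(2) by metis
    have 1: "perm_restrict \<sigma> (A - C) permutes (A - C)"
      by (rule perm_restrict_diff_cyclic[OF s(1) cyc])
    have inC: "\<sigma> x \<in> C" if "x \<in> C" for x by (rule cyclic_on_inI[OF cyc that])
    have 2: "perm_restrict \<sigma> C permutes C"
    proof (rule bij_imp_permutes)
      have "inj_on (perm_restrict \<sigma> C) C"
        using permutes_inj[OF s(1)] by (auto simp: inj_on_def perm_restrict_def)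
      moreover have "perm_restrict \<sigma> C ` C \<subseteq> C" using inC by (auto simp: perm_restrict_def)
      ultimately show "bij_betw (perm_restrict \<sigma> C) C C"
        by (metis assms(1,3) bij_betw_imageI endo_inj_surj rev_finite_subset)
    qed (simp add: perm_restrict_def)
    have 3: "orbit (perm_restrict \<sigma> C) a = orbit \<sigma> a"
      by (rule orbit_cong0[of _ C]) (use assms inC in \<open>auto simp: perm_restrict_def\<close>)
    show "(perm_restrict \<sigma> C, perm_restrict \<sigma> (A - C)) \<in>
       perms_with_orbit C a C \<times> {\<tau>. \<tau> permutes (A - C)}"
      using 1 2 3 s(2) by simp
  qed
  show "(\<lambda>\<sigma>. (perm_restrict \<sigma> C, perm_restrict \<sigma> (A - C))) ((\<lambda>(\<rho>, \<tau>). \<rho> \<circ> \<tau>) x) = x"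
    if "x \<in> perms_with_orbit C a C \<times> {\<tau>. \<tau> permutes (A - C)}" for x
  proof -
    obtain \<rho> \<tau> where x: "x = (\<rho>, \<tau>)" "\<rho> permutes C" "\<tau> permutes (A - C)" using \<open>x \<in> _\<close> by auto
    have "perm_restrict (\<rho> \<circ> \<tau>) C = \<rho>"
      using x by (auto simp: perm_restrict_def fun_eq_iff permutes_not_in)
    moreover have "\<tau> y \<in> A - C" if "y \<in> A - C" for y using x(3) that by (metis permutes_in_image)
    then have "perm_restrict (\<rho> \<circ> \<tau>) (A - C) = \<tau>"
      using x by (auto simp: perm_restrict_def fun_eq_iff permutes_not_in)
    ultimately show ?thesis using x by simp
  qed
  show "(\<lambda>(\<rho>, \<tau>). \<rho> \<circ> \<tau>) ((\<lambda>\<sigma>. (perm_restrict \<sigma> C, perm_restrict \<sigma> (A - C))) \<sigma>) = \<sigma>"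
    if h: "\<sigma> \<in> perms_with_orbit A a C" for \<sigma>
  proof -
    have s: "\<sigma> permutes A" "orbit \<sigma> a = C" using h by auto
    have cyc: "cyclic_on \<sigma> C" using cyclic_on_orbit[OF s(1) assms(1)] s(2) by metis
    have "\<sigma> y \<notin> C" if "y \<in> A - C" for y using cyclic_on_f_in[OF s(1) cyc] that by blast
    then show ?thesis
      using s(1) by (auto simp: perm_restrict_def fun_eq_iff permutes_not_in permutes_in_image)
  qed
qed

lemma sum_perms_split_off_orbit:
  fixes F :: "('a \<Rightarrow> 'a) \<Rightarrow> 'b :: comm_monoid_add"
  assumes "finite A" "a \<in> A"
  shows "(\<Sum>\<sigma> | \<sigma> permutes A. F \<sigma>) =
    (\<Sum>C | a \<in> C \<and> C \<subseteq> A. \<Sum>\<rho>\<in>perms_with_orbit C a C. \<Sum>\<tau> | \<tau> permutes (A - C). F (\<rho> \<circ> \<tau>))"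
proof -
  have "(\<Sum>\<sigma> | \<sigma> permutes A. F \<sigma>) =
      (\<Sum>C | a \<in> C \<and> C \<subseteq> A. \<Sum>\<sigma>\<in>{\<sigma> \<in> {\<sigma>. \<sigma> permutes A}. orbit \<sigma> a = C}. F \<sigma>)"
  proof (rule sum.group[symmetric])
    show "finite {\<sigma>. \<sigma> permutes A}" "finite {C. a \<in> C \<and> C \<subseteq> A}"
      using assms finite_permutations by auto
    show "(\<lambda>\<sigma>. orbit \<sigma> a) ` {\<sigma>. \<sigma> permutes A} \<subseteq> {C. a \<in> C \<and> C \<subseteq> A}"
    proof (rule image_subsetI)
      fix \<sigma> assume "\<sigma> \<in> {\<sigma>. \<sigma> permutes A}"
      then have s: "\<sigma> permutes A" by simp
      show "orbit \<sigma> a \<in> {C. a \<in> C \<and> C \<subseteq> A}"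
        using permutes_orbit_subset[OF s assms(2)] self_in_orbit_permutes[OF s assms(1)] by simp
    qed
  qed
  also have "\<dots> = (\<Sum>C | a \<in> C \<and> C \<subseteq> A. \<Sum>\<rho>\<in>perms_with_orbit C a C. \<Sum>\<tau> | \<tau> permutes (A - C). F (\<rho> \<circ> \<tau>))"
  proof (rule sum.cong[OF refl])
    fix C assume C: "C \<in> {C. a \<in> C \<and> C \<subseteq> A}"
    have "(\<Sum>\<sigma>\<in>perms_with_orbit A a C. F \<sigma>) =
        (\<Sum>x\<in>perms_with_orbit C a C \<times> {\<tau>. \<tau> permutes (A - C)}. F ((\<lambda>(\<rho>, \<tau>). \<rho> \<circ> \<tau>) x))"
      using bij_betw_split_off_orbit[OF assms(1)] C by (intro sum.reindex_bij_betw[symmetric]) auto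
    also have "\<dots> = (\<Sum>\<rho>\<in>perms_with_orbit C a C. \<Sum>\<tau> | \<tau> permutes (A - C). F (\<rho> \<circ> \<tau>))"
      by (simp add: sum.cartesian_product case_prod_beta)
    finally show "(\<Sum>\<sigma>\<in>{\<sigma> \<in> {\<sigma>. \<sigma> permutes A}. orbit \<sigma> a = C}. F \<sigma>) = \<dots>" by simp
  qed
  finally show ?thesis .
qed

lemma sum_subsets_containing:
  fixes f :: "nat \<Rightarrow> 'b :: semiring_1"
  assumes "finite A" "a \<in> A"
  shows "(\<Sum>C | a \<in> C \<and> C \<subseteq> A. f (card C)) =
    (\<Sum>j=1..card A. of_nat ((card A - 1) choose (j - 1)) * f j)"
proof -
  have "(\<Sum>C | a \<in> C \<and> C \<subseteq> A. f (card C)) = (\<Sum>B\<in>Pow (A - {a}). f (Suc (card B)))"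
  proof (rule sum.reindex_bij_witness[where i = "insert a" and j = "\<lambda>C. C - {a}"])
    show "f (Suc (card (C - {a}))) = f (card C)" if "C \<in> {C. a \<in> C \<and> C \<subseteq> A}" for C
      using that assms by (metis (mono_tags, lifting) card_Suc_Diff1 finite_subset mem_Collect_eq)
  qed (use assms in auto)
  also have "\<dots> = (\<Sum>k\<le>card (A - {a}). \<Sum>B\<in>{B \<in> Pow (A - {a}). card B = k}. f (Suc (card B)))"
  proof (rule sum.group[symmetric])
    show "card ` Pow (A - {a}) \<subseteq> {..card (A - {a})}"
      using assms by (metis PowD atMost_iff card_mono finite_Diff image_subsetI)
  qed (use assms in auto)
  also have "\<dots> = (\<Sum>k\<le>card A - 1. of_nat ((card A - 1) choose k) * f (Suc k))"
  proof (rule sum.cong)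
    fix k
    have "(\<Sum>B\<in>{B \<in> Pow (A - {a}). card B = k}. f (Suc (card B))) =
        of_nat (card {B. B \<subseteq> A - {a} \<and> card B = k}) * f (Suc k)"
      by (simp add: Pow_def)
    then show "(\<Sum>B\<in>{B \<in> Pow (A - {a}). card B = k}. f (Suc (card B))) =
        of_nat ((card A - 1) choose k) * f (Suc k)"
      using assms by (simp add: n_subsets)
  qed (use assms in auto)
  also have "\<dots> = (\<Sum>j=1..card A. of_nat ((card A - 1) choose (j - 1)) * f j)"
  proof (rule sum.reindex_bij_witness[where i = "\<lambda>j. j - 1" and j = Suc])
    have "card A > 0" using assms card_gt_0_iff by blast
    then show "Suc k \<in> {1..card A}" if "k \<in> {..card A - 1}" for k using that by auto
  qed auto
  finally show ?thesis .
qed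

lemma binomial_times_fact:
  assumes "j \<in> {1..n}"
  shows "(n - 1 choose (j - 1)) * fact (j - 1) * fact (n - j) = (fact (n - 1) :: nat)"
proof -
  have "fact (j - 1) * fact (n - 1 - (j - 1)) * (n - 1 choose (j - 1)) = (fact (n - 1) :: nat)"
    by (rule binomial_fact_lemma) (use assms in auto)
  moreover have "n - 1 - (j - 1) = n - j" using assms by auto
  ultimately show ?thesis by (simp add: mult_ac)
qed

text \<open>
  Decomposing all permutations by the cycle of \<open>a\<close> and counting gives
  \<open>fact n\<close> as a sum over the possible cycles \<open>C\<close>. The claimed value solves this equation, since every
  cycle length then contributes \<open>fact (n - 1)\<close>. By induction the summands with \<open>C\<close> smaller than
  \<open>A\<close> are known, which leaves only the summand for \<open>C = A\<close>.
\<close>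
lemma card_cyclic_perms:
  assumes "finite A" "a \<in> A"
  shows "card (perms_with_orbit A a A) = fact (card A - 1)"
  using assms
proof (induction "card A" arbitrary: A rule: less_induct)
  case less
  let ?S = "{C. a \<in> C \<and> C \<subseteq> A}"
  let ?n = "card A"
  have fin: "finite ?S" using less.prems by auto
  have A: "A \<in> ?S" using less.prems by auto
  have "?n > 0" using less.prems card_gt_0_iff by blast
  have "(\<Sum>C\<in>?S. card (perms_with_orbit C a C) * fact (?n - card C)) = (fact ?n :: nat)"
  proof -
    have "(\<Sum>C\<in>?S. card (perms_with_orbit C a C) * fact (?n - card C)) =
        (\<Sum>C\<in>?S. \<Sum>\<rho>\<in>perms_with_orbit C a C. \<Sum>\<tau> | \<tau> permutes (A - C). 1 :: nat)"
    proof (rule sum.cong[OF refl])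
      fix C assume C: "C \<in> ?S"
      have "card {\<tau>. \<tau> permutes (A - C)} = fact (?n - card C)"
        using C less.prems by (intro card_permutations) (auto simp: card_Diff_subset finite_subset)
      then show "card (perms_with_orbit C a C) * fact (?n - card C) =
          (\<Sum>\<rho>\<in>perms_with_orbit C a C. \<Sum>\<tau> | \<tau> permutes (A - C). 1 :: nat)"
        by simp
    qed
    also have "\<dots> = (\<Sum>\<sigma> | \<sigma> permutes A. 1)"
      by (rule sum_perms_split_off_orbit[symmetric]) (use less.prems in auto)
    also have "\<dots> = fact ?n"
      using card_permutations[OF refl less.prems(1)] by simp
    finally show ?thesis .
  qed
  \<comment> \<open>the claimed values satisfy the same equation as the true cardinalities\<close>
  moreover have "(\<Sum>C\<in>?S. fact (card C - 1) * fact (?n - card C)) = (fact ?n :: nat)"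
  proof -
    have "(\<Sum>C\<in>?S. fact (card C - 1) * fact (?n - card C)) =
        (\<Sum>j=1..?n. (?n - 1 choose (j - 1)) * (fact (j - 1) * fact (?n - j)) :: nat)"
      using sum_subsets_containing[OF less.prems, of "\<lambda>j. fact (j - 1) * fact (?n - j) :: nat"] by simp
    also have "\<dots> = (\<Sum>j=1..?n. fact (?n - 1))"
      by (intro sum.cong[OF refl]) (metis binomial_times_fact mult.assoc)
    also have "\<dots> = ?n * fact (?n - 1)" by simp
    also have "\<dots> = fact ?n" using \<open>?n > 0\<close> by (simp add: fact_reduce)
    finally show ?thesis .
  qed
  moreover have "(\<Sum>C\<in>?S - {A}. card (perms_with_orbit C a C) * fact (?n - card C)) =
      (\<Sum>C\<in>?S - {A}. fact (card C - 1) * fact (?n - card C) :: nat)"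
  proof (rule sum.cong[OF refl])
    fix C assume C: "C \<in> ?S - {A}"
    then have "card C < card A" using less.prems by (intro psubset_card_mono) auto
    then show "card (perms_with_orbit C a C) * fact (?n - card C) =
        (fact (card C - 1) * fact (?n - card C) :: nat)"
      using less.hyps[of C] C less.prems finite_subset by auto
  qed
  ultimately show ?case
    using sum.remove[OF fin A, of "\<lambda>C. card (perms_with_orbit C a C) * fact (?n - card C)"]
      sum.remove[OF fin A, of "\<lambda>C. fact (card C - 1) * fact (?n - card C) :: nat"] by simp
qed

text \<open>
  Summing over points instead of cycles incorporates the factor \<open>j\<close> in front of the number of cycles
  of length \<open>j\<close>.
\<close>
definition orbit_sum :: "(nat \<Rightarrow> real) \<Rightarrow> 'a set \<Rightarrow> ('a \<Rightarrow> 'a) \<Rightarrow> real" where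
  "orbit_sum u A \<sigma> = (\<Sum>e\<in>A. u (card (orbit \<sigma> e)))"

text \<open>
  The \<open>k\<close>-th moment of \<open>orbit_sum u\<close> under the uniform distribution on the permutations of \<open>n\<close>
  points. In the recursion \<open>j\<close> is the length of the cycle through a marked point, and the binomial
  theorem is applied to the contribution \<open>j * u j\<close> of that cycle plus the contribution of the rest.
\<close>
fun orbit_sum_moment :: "(nat \<Rightarrow> real) \<Rightarrow> nat \<Rightarrow> nat \<Rightarrow> real" where
  "orbit_sum_moment u 0 n = 1"
| "orbit_sum_moment u (Suc k) n =
    (\<Sum>i\<le>k. of_nat (k choose i) *
      (\<Sum>j=1..n. of_nat j ^ i * u j ^ Suc i * orbit_sum_moment u (k - i) (n - j)))"

text \<open>
  A marked point of a uniform permutation sees its own cycle \<open>C\<close>, which can be chosen cyclically in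
  \<open>fact (card C - 1)\<close> ways, and an independent permutation of the other points.
\<close>
lemma sum_perms_weighted_orbit:
  fixes u :: "nat \<Rightarrow> real" and g :: "nat \<Rightarrow> real \<Rightarrow> real"
  assumes "finite A" "a \<in> A"
  shows "(\<Sum>\<sigma> | \<sigma> permutes A. g (card (orbit \<sigma> a)) (orbit_sum u A \<sigma>)) =
    (\<Sum>C | a \<in> C \<and> C \<subseteq> A. fact (card C - 1) *
      (\<Sum>\<tau> | \<tau> permutes (A - C). g (card C) (card C * u (card C) + orbit_sum u (A - C) \<tau>)))"
proof -
  have "(\<Sum>\<rho>\<in>perms_with_orbit C a C. \<Sum>\<tau> | \<tau> permutes (A - C).
      g (card (orbit (\<rho> \<circ> \<tau>) a)) (orbit_sum u A (\<rho> \<circ> \<tau>))) = fact (card C - 1) *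
      (\<Sum>\<tau> | \<tau> permutes (A - C). g (card C) (card C * u (card C) + orbit_sum u (A - C) \<tau>))"
    if C: "a \<in> C" "C \<subseteq> A" for C
  proof -
    have "finite C" using C assms finite_subset by blast
    have "g (card (orbit (\<rho> \<circ> \<tau>) a)) (orbit_sum u A (\<rho> \<circ> \<tau>)) =
        g (card C) (card C * u (card C) + orbit_sum u (A - C) \<tau>)"
      if \<rho>: "\<rho> \<in> perms_with_orbit C a C" and \<tau>: "\<tau> permutes (A - C)" for \<rho> \<tau>
    proof -
      have left: "orbit (\<rho> \<circ> \<tau>) e = C" if "e \<in> C" for e
      proof -
        have "orbit (\<rho> \<circ> \<tau>) e = orbit \<rho> e"
          by (rule orbit_comp_left[OF _ \<tau> _ that]) (use \<rho> in auto)
        moreover have "cyclic_on \<rho> C" using cyclic_on_orbit[of \<rho> C a] \<rho> \<open>finite C\<close> by auto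
        ultimately show ?thesis using orbit_cyclic_eq3[OF _ that] by metis
      qed
      have right: "orbit (\<rho> \<circ> \<tau>) e = orbit \<tau> e" if "e \<in> A - C" for e
        by (rule orbit_comp_right[OF _ \<tau> _ that]) (use \<rho> in auto)
      have "orbit_sum u A (\<rho> \<circ> \<tau>) = (\<Sum>e\<in>C. u (card (orbit (\<rho> \<circ> \<tau>) e))) +
          (\<Sum>e\<in>A - C. u (card (orbit (\<rho> \<circ> \<tau>) e)))"
        unfolding orbit_sum_def by (subst sum.subset_diff[OF C(2) assms(1)]) (rule add.commute)
      also have "\<dots> = card C * u (card C) + orbit_sum u (A - C) \<tau>"
        unfolding orbit_sum_def using left right by simp
      finally show ?thesis using left C by simp
    qed
    then show ?thesis
      using card_cyclic_perms[OF \<open>finite C\<close> C(1)] by simp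
  qed
  then show ?thesis
    by (subst sum_perms_split_off_orbit[OF assms]) (auto intro!: sum.cong)
qed

text \<open>
  One of the factors is expanded over the points of \<open>A\<close>. By symmetry every point contributes the same
  amount, and conditioning on its cycle reduces the power.
\<close>
lemma sum_perms_orbit_sum_power:
  assumes "finite A"
  shows "(\<Sum>\<sigma> | \<sigma> permutes A. orbit_sum u A \<sigma> ^ k) = fact (card A) * orbit_sum_moment u k (card A)"
  using assms
proof (induction k arbitrary: A rule: less_induct)
  case (less k)
  show ?case
  proof (cases k)
    case 0
    then show ?thesis using card_permutations[OF refl less.prems] by simp
  next
    case (Suc l)
    let ?n = "card A"
    let ?M = "orbit_sum_moment u"
    define R where "R j = u j * (\<Sum>i\<le>l. of_nat (l choose i) * (j * u j) ^ i * ?M (l - i) (?n - j))" for j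
    have "(\<Sum>\<sigma> | \<sigma> permutes A. orbit_sum u A \<sigma> ^ k) =
        (\<Sum>\<sigma> | \<sigma> permutes A. \<Sum>a\<in>A. u (card (orbit \<sigma> a)) * orbit_sum u A \<sigma> ^ l)"
      by (simp add: Suc orbit_sum_def sum_distrib_right)
    also have "\<dots> = (\<Sum>a\<in>A. \<Sum>\<sigma> | \<sigma> permutes A. u (card (orbit \<sigma> a)) * orbit_sum u A \<sigma> ^ l)"
      by (rule sum.swap)
    also have "\<dots> = (\<Sum>a\<in>A. fact (?n - 1) * (\<Sum>j=1..?n. R j))"
    proof (rule sum.cong[OF refl])
      fix a assume a: "a \<in> A"
      have "(\<Sum>\<sigma> | \<sigma> permutes A. u (card (orbit \<sigma> a)) * orbit_sum u A \<sigma> ^ l) =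
          (\<Sum>C | a \<in> C \<and> C \<subseteq> A. fact (card C - 1) * (\<Sum>\<tau> | \<tau> permutes (A - C).
            u (card C) * (card C * u (card C) + orbit_sum u (A - C) \<tau>) ^ l))"
        using sum_perms_weighted_orbit[OF less.prems a, of "\<lambda>c s. u c * s ^ l"] by simp
      also have "\<dots> = (\<Sum>C | a \<in> C \<and> C \<subseteq> A. fact (card C - 1) * (fact (?n - card C) * R (card C)))"
      proof (rule sum.cong[OF refl])
        fix C assume "C \<in> {C. a \<in> C \<and> C \<subseteq> A}"
        then have C: "a \<in> C" "C \<subseteq> A" "finite C" using less.prems finite_subset by auto
        have "(\<Sum>\<tau> | \<tau> permutes (A - C). u (card C) * (card C * u (card C) + orbit_sum u (A - C) \<tau>) ^ l)
            = u (card C) * (\<Sum>i\<le>l. of_nat (l choose i) * (card C * u (card C)) ^ i *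
                (\<Sum>\<tau> | \<tau> permutes (A - C). orbit_sum u (A - C) \<tau> ^ (l - i)))"
          by (simp add: binomial_ring sum_distrib_left mult.assoc)
             (rule sum.swap)
        also have "\<dots> = fact (?n - card C) * R (card C)"
        proof -
          have "(\<Sum>\<tau> | \<tau> permutes (A - C). orbit_sum u (A - C) \<tau> ^ (l - i)) =
              fact (?n - card C) * ?M (l - i) (?n - card C)" for i
            using less.IH[of "l - i" "A - C"] Suc less.prems C by (simp add: card_Diff_subset)
          then show ?thesis by (simp add: R_def sum_distrib_left mult_ac)
        qed
        finally show "fact (card C - 1) * (\<Sum>\<tau> | \<tau> permutes (A - C).
            u (card C) * (card C * u (card C) + orbit_sum u (A - C) \<tau>) ^ l) =
            fact (card C - 1) * (fact (?n - card C) * R (card C))" by simp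
      qed
      also have "\<dots> = (\<Sum>j=1..?n. of_nat (?n - 1 choose (j - 1)) * (fact (j - 1) * (fact (?n - j) * R j)))"
        by (rule sum_subsets_containing[OF less.prems a])
      also have "\<dots> = (\<Sum>j=1..?n. fact (?n - 1) * R j)"
      proof (rule sum.cong[OF refl])
        fix j assume "j \<in> {1..?n}"
        from arg_cong[OF binomial_times_fact[OF this], of real]
        show "of_nat (?n - 1 choose (j - 1)) * (fact (j - 1) * (fact (?n - j) * R j)) = fact (?n - 1) * R j"
          by (simp add: mult.assoc[symmetric])
      qed
      finally show "(\<Sum>\<sigma> | \<sigma> permutes A. u (card (orbit \<sigma> a)) * orbit_sum u A \<sigma> ^ l) =
          fact (?n - 1) * (\<Sum>j=1..?n. R j)" by (simp add: sum_distrib_left)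
    qed
    also have "\<dots> = fact ?n * (\<Sum>j=1..?n. R j)"
      using fact_reduce[of ?n, where 'a = real] by (cases "?n = 0") auto
    also have "(\<Sum>j=1..?n. R j) = ?M k ?n"
      unfolding R_def Suc orbit_sum_moment.simps
      by (simp add: sum_distrib_left power_mult_distrib mult_ac) (rule sum.swap)
    finally show ?thesis .
  qed
qed

lemma sum_cycle_count_eq_orbit_sum:
  fixes u :: "nat \<Rightarrow> real"
  assumes "\<sigma> permutes A" "finite A"
  shows "(\<Sum>j=1..card A. real j * real (card {S. S \<subseteq> A \<and> cyclic_on \<sigma> S \<and> card S = j}) * u j) = orbit_sum u A \<sigma>"
proof -
  have "orbit_sum u A \<sigma> = (\<Sum>j=1..card A. \<Sum>e\<in>{e \<in> A. card (orbit \<sigma> e) = j}. u (card (orbit \<sigma> e)))"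
    unfolding orbit_sum_def
  proof (rule sum.group[symmetric])
    show "(\<lambda>e. card (orbit \<sigma> e)) ` A \<subseteq> {1..card A}"
    proof (rule image_subsetI)
      fix e assume "e \<in> A"
      then have sub: "orbit \<sigma> e \<subseteq> A" by (rule permutes_orbit_subset[OF assms(1)])
      have "card (orbit \<sigma> e) > 0"
        using finite_subset[OF sub assms(2)] by (simp add: card_gt_0_iff orbit_nonempty)
      then show "card (orbit \<sigma> e) \<in> {1..card A}" using card_mono[OF assms(2) sub] by simp
    qed
  qed (use assms in auto)
  also have "\<dots> = (\<Sum>j=1..card A. real j * real (card {S. S \<subseteq> A \<and> cyclic_on \<sigma> S \<and> card S = j}) * u j)"
  proof (rule sum.cong[OF refl])
    fix j
    let ?C = "{S. S \<subseteq> A \<and> cyclic_on \<sigma> S \<and> card S = j}"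
    have "{e \<in> A. card (orbit \<sigma> e) = j} = \<Union>?C"
    proof (intro set_eqI iffI)
      fix e assume e: "e \<in> {e \<in> A. card (orbit \<sigma> e) = j}"
      then have "orbit \<sigma> e \<in> ?C"
        using permutes_orbit_subset[OF assms(1)] cyclic_on_orbit[OF assms] by simp
      then show "e \<in> \<Union>?C" using self_in_orbit_permutes[OF assms, of e] by (rule UnionI)
    next
      fix e assume "e \<in> \<Union>?C"
      then obtain S where S: "S \<subseteq> A" "cyclic_on \<sigma> S" "card S = j" "e \<in> S" by blast
      then show "e \<in> {e \<in> A. card (orbit \<sigma> e) = j}" using orbit_cyclic_eq3[OF S(2,4)] by auto
    qed
    moreover have "card (\<Union>?C) = j * card ?C"
    proof (rule card_partition[symmetric])
      show "finite ?C" by (rule finite_subset[of _ "Pow A"]) (use assms in auto)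
      show "finite (\<Union>?C)" by (rule finite_subset[of _ A]) (use assms in auto)
      show "card c = j" if "c \<in> ?C" for c using that by simp
      show "c1 \<inter> c2 = {}" if "c1 \<in> ?C" "c2 \<in> ?C" "c1 \<noteq> c2" for c1 c2
      proof (rule ccontr)
        assume "c1 \<inter> c2 \<noteq> {}"
        then obtain x where x: "x \<in> c1" "x \<in> c2" by blast
        have "orbit \<sigma> x = c1" "orbit \<sigma> x = c2" using that x orbit_cyclic_eq3[of \<sigma> _ x] by simp_all
        then show False using that(3) by simp
      qed
    qed
    ultimately have "card {e \<in> A. card (orbit \<sigma> e) = j} = j * card ?C" by simp
    moreover have "(\<Sum>e\<in>{e \<in> A. card (orbit \<sigma> e) = j}. u (card (orbit \<sigma> e))) =
        (\<Sum>e\<in>{e \<in> A. card (orbit \<sigma> e) = j}. u j)" by (rule sum.cong) auto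
    ultimately show "(\<Sum>e\<in>{e \<in> A. card (orbit \<sigma> e) = j}. u (card (orbit \<sigma> e))) =
        real j * real (card ?C) * u j" by simp
  qed
  finally show ?thesis ..
qed

section \<open>Asymptotics of the moments\<close>

lemma average_tendsto_zero:
  fixes e :: "nat \<Rightarrow> real"
  assumes "e \<longlonglongrightarrow> 0"
  shows "(\<lambda>n. (\<Sum>l<n. \<bar>e l\<bar>) / n) \<longlonglongrightarrow> 0"
proof (rule LIMSEQ_I)
  fix r :: real assume "r > 0"
  then obtain N where N: "\<And>l. l \<ge> N \<Longrightarrow> \<bar>e l\<bar> < r / 2"
    using LIMSEQ_D[OF assms, of "r / 2"] by auto
  define S where "S = (\<Sum>l<N. \<bar>e l\<bar>)"
  have "(\<lambda>n. S / real n) \<longlonglongrightarrow> 0" by (rule lim_const_over_n)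
  from LIMSEQ_D[OF this, of "r / 2"] \<open>r > 0\<close>
  obtain M where M: "\<And>n. n \<ge> M \<Longrightarrow> norm (S / real n - 0) < r / 2" using half_gt_zero by blast
  show "\<exists>no. \<forall>n\<ge>no. norm ((\<Sum>l<n. \<bar>e l\<bar>) / n - 0) < r"
  proof (intro exI allI impI)
    fix n assume n: "n \<ge> max (max M N) 1"
    have "(\<Sum>l<n. \<bar>e l\<bar>) = S + (\<Sum>l=N..<n. \<bar>e l\<bar>)"
      using n unfolding S_def lessThan_atLeast0 by (subst sum.atLeastLessThan_concat) auto
    also have "(\<Sum>l=N..<n. \<bar>e l\<bar>) \<le> (\<Sum>l=N..<n. r / 2)"
      using N by (intro sum_mono) (auto intro: less_imp_le)
    also have "\<dots> \<le> n * (r / 2)" using \<open>r > 0\<close> by simp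
    finally have "(\<Sum>l<n. \<bar>e l\<bar>) / n \<le> S / n + r / 2" using n by (simp add: field_simps)
    moreover have "S / n < r / 2" using M[of n] n by (simp add: abs_if split: if_splits)
    moreover have "(\<Sum>l<n. \<bar>e l\<bar>) / n \<ge> 0" by (simp add: sum_nonneg)
    moreover have "(\<Sum>l<n. \<bar>e l\<bar>) / n < r"
      using calculation(1,2) unfolding less_divide_eq_numeral1 by argo
    ultimately show "norm ((\<Sum>l<n. \<bar>e l\<bar>) / n - 0) < r" by simp
  qed
qed

text \<open>
  The increments of \<open>n ^ Suc q / Suc q\<close> are asymptotic to \<open>n ^ q\<close>, so \<open>x\<close> differs from
  \<open>c\<close> times these increments by \<open>e l * Suc l ^ q\<close> with a null sequence \<open>e\<close>. The increments telescope, and the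
  error is controlled by the averages of \<open>\<bar>e l\<bar>\<close>.
\<close>
lemma partial_sums_of_power_growth:
  fixes x :: "nat \<Rightarrow> real"
  assumes "(\<lambda>n. x n / n ^ q) \<longlonglongrightarrow> c"
  shows "(\<lambda>n. (\<Sum>l<n. x l) / n ^ Suc q) \<longlonglongrightarrow> c / Suc q"
proof -
  define r :: "nat \<Rightarrow> real" where "r l = real l / real (Suc l)" for l
  have r: "r \<longlonglongrightarrow> 1" unfolding r_def by (rule LIMSEQ_n_over_Suc_n)
  define p :: "nat \<Rightarrow> real" where "p l = (real (Suc l) ^ Suc q - real l ^ Suc q) / Suc q" for l
  have p: "p l / real (Suc l) ^ q = (\<Sum>i<Suc q. r l ^ (q - i)) / Suc q" for l
  proof -
    have "real (Suc l) ^ Suc q - real l ^ Suc q = (\<Sum>i<Suc q. real l ^ (q - i) * real (Suc l) ^ i)"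
      using diff_power_eq_sum[of "real (Suc l)" q "real l"] by (simp add: mult.commute)
    then have "p l / real (Suc l) ^ q =
        (\<Sum>i<Suc q. real l ^ (q - i) * real (Suc l) ^ i / real (Suc l) ^ q) / Suc q"
      by (simp only: p_def sum_divide_distrib[symmetric]) (simp only: divide_divide_eq_left mult.commute)
    also have "(\<Sum>i<Suc q. real l ^ (q - i) * real (Suc l) ^ i / real (Suc l) ^ q) =
        (\<Sum>i<Suc q. r l ^ (q - i))"
      by (intro sum.cong refl) (auto simp: r_def power_divide field_simps simp flip: power_add)
    finally show ?thesis .
  qed
  define e where "e l = (x l - c * p l) / real (Suc l) ^ q" for l
  have "(\<lambda>l. x l / l ^ q * r l ^ q - c * ((\<Sum>i<Suc q. r l ^ (q - i)) / Suc q))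
      \<longlonglongrightarrow> c * 1 ^ q - c * ((\<Sum>i<Suc q. 1 ^ (q - i)) / Suc q)"
    by (intro tendsto_intros assms r) auto
  moreover have "\<forall>\<^sub>F l in sequentially. x l / l ^ q * r l ^ q - c * ((\<Sum>i<Suc q. r l ^ (q - i)) / Suc q) = e l"
  proof (intro eventually_sequentiallyI[of 1])
    fix l :: nat assume "l \<ge> 1"
    then show "x l / l ^ q * r l ^ q - c * ((\<Sum>i<Suc q. r l ^ (q - i)) / Suc q) = e l"
      unfolding p[symmetric] e_def by (simp add: r_def power_divide field_simps)
  qed
  ultimately have "e \<longlonglongrightarrow> 0" by (subst (asm) tendsto_cong) auto
  from average_tendsto_zero[OF this]
  have "(\<lambda>n. (\<Sum>l<n. x l) / n ^ Suc q - c / Suc q) \<longlonglongrightarrow> 0"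
  proof (rule Lim_null_comparison[rotated])
    show "\<forall>\<^sub>F n in sequentially. norm ((\<Sum>l<n. x l) / n ^ Suc q - c / Suc q) \<le> (\<Sum>l<n. \<bar>e l\<bar>) / n"
    proof (intro eventually_sequentiallyI[of 1])
      fix n :: nat assume n: "n \<ge> 1"
      have "(\<Sum>l<n. p l) = real n ^ Suc q / Suc q"
        unfolding p_def sum_divide_distrib[symmetric] by (subst sum_lessThan_telescope) simp
      moreover have "x l = c * p l + e l * real (Suc l) ^ q" for l
        by (simp add: e_def)
      then have "(\<Sum>l<n. x l) = c * (\<Sum>l<n. p l) + (\<Sum>l<n. e l * real (Suc l) ^ q)"
        by (simp add: sum.distrib sum_distrib_left)
      ultimately have "(\<Sum>l<n. x l) / n ^ Suc q - c / Suc q = (\<Sum>l<n. e l * real (Suc l) ^ q) / n ^ Suc q"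
        using n by (simp only: add_divide_distrib) simp
      also have "\<bar>\<dots>\<bar> \<le> (\<Sum>l<n. \<bar>e l\<bar> * real n ^ q) / n ^ Suc q"
        unfolding abs_divide
        by (intro divide_mono order.trans[OF sum_abs] sum_mono)
           (use n in \<open>auto simp: abs_mult intro!: mult_left_mono power_mono sum_nonneg\<close>)
      also have "\<dots> = (\<Sum>l<n. \<bar>e l\<bar>) / n" using n by (simp add: sum_distrib_right[symmetric])
      finally show "norm ((\<Sum>l<n. x l) / n ^ Suc q - c / Suc q) \<le> (\<Sum>l<n. \<bar>e l\<bar>) / n" by simp
    qed
  qed
  then show ?thesis by (simp add: LIM_zero_iff)
qed

text \<open>
  Summation by parts raises the exponent \<open>i\<close> by one.
\<close>
lemma power_weighted_sum:
  fixes v :: "nat \<Rightarrow> real"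
  assumes "(\<lambda>n. (\<Sum>j=1..n. v j) / n) \<longlonglongrightarrow> \<mu>"
  shows "(\<lambda>n. (\<Sum>j=1..n. real j ^ i * v j) / n ^ Suc i) \<longlonglongrightarrow> \<mu> / Suc i"
proof (induction i)
  case 0
  then show ?case using assms by simp
next
  case (Suc i)
  define V where "V i n = (\<Sum>j=1..n. real j ^ i * v j)" for i n
  \<comment> \<open>summation by parts against the partial sums of the previous weight\<close>
  have parts: "V (Suc i) n = n * V i n - (\<Sum>l<n. V i l)" for n
    by (induction n) (auto simp: V_def algebra_simps)
  have "(\<lambda>n. V i n / n ^ Suc i - (\<Sum>l<n. V i l) / n ^ Suc (Suc i))
      \<longlonglongrightarrow> \<mu> / Suc i - \<mu> / Suc i / Suc (Suc i)"
    unfolding V_def by (intro tendsto_diff partial_sums_of_power_growth Suc)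
  also have "(\<lambda>n. V i n / n ^ Suc i - (\<Sum>l<n. V i l) / n ^ Suc (Suc i)) = (\<lambda>n. V (Suc i) n / n ^ Suc (Suc i))"
  proof
    fix n :: nat
    show "V i n / n ^ Suc i - (\<Sum>l<n. V i l) / n ^ Suc (Suc i) = V (Suc i) n / n ^ Suc (Suc i)"
      unfolding parts by (cases "n = 0") (auto simp: field_simps)
  qed
  also have "\<mu> / Suc i - \<mu> / Suc i / Suc (Suc i) = \<mu> / Suc (Suc i)"
    by (simp add: divide_simps) (simp add: algebra_simps)
  finally show ?case by (simp only: V_def)
qed

text \<open>
  The limit is \<open>\<mu>\<close> times the Beta integral of \<open>x ^ i * (1 - x) ^ p\<close>. Writing one factor
  \<open>n - j\<close> as a difference expresses the case \<open>(i, p + 1)\<close> by the cases \<open>(i, p)\<close> and \<open>(i + 1, p)\<close>,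
  both for the sums and for the limits.
\<close>
lemma beta_weighted_sum:
  fixes v :: "nat \<Rightarrow> real"
  assumes "(\<lambda>n. (\<Sum>j=1..n. v j) / n) \<longlonglongrightarrow> \<mu>"
  shows "(\<lambda>n. (\<Sum>j=1..n. real j ^ i * real (n - j) ^ p * v j) / n ^ Suc (i + p))
    \<longlonglongrightarrow> \<mu> * (fact i * fact p / fact (Suc (i + p)))"
proof (induction p arbitrary: i)
  case 0
  have "\<mu> / Suc i = \<mu> * (fact i * fact 0 / fact (Suc (i + 0)))"
    by simp
  then show ?case using power_weighted_sum[OF assms, of i] by simp
next
  case (Suc p)
  define W where "W i p n = (\<Sum>j=1..n. real j ^ i * real (n - j) ^ p * v j) / n ^ Suc (i + p)" for i p n
  have "W i (Suc p) n = W i p n - W (Suc i) p n" for n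
  proof (cases "n = 0")
    case False
    have "(\<Sum>j=1..n. real j ^ i * real (n - j) ^ Suc p * v j) =
        (\<Sum>j=1..n. real n * (real j ^ i * real (n - j) ^ p * v j) - real j ^ Suc i * real (n - j) ^ p * v j)"
      by (intro sum.cong refl) (auto simp: of_nat_diff algebra_simps)
    also have "\<dots> = real n * (\<Sum>j=1..n. real j ^ i * real (n - j) ^ p * v j) -
        (\<Sum>j=1..n. real j ^ Suc i * real (n - j) ^ p * v j)"
      by (simp only: sum_subtractf sum_distrib_left)
    finally show ?thesis using False by (simp only: W_def) (simp add: diff_divide_distrib)
  qed (simp add: W_def)
  moreover have "(\<lambda>n. W i p n - W (Suc i) p n) \<longlonglongrightarrow>
      \<mu> * (fact i * fact p / fact (Suc (i + p))) - \<mu> * (fact (Suc i) * fact p / fact (Suc (Suc i + p)))"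
    unfolding W_def by (intro tendsto_diff Suc)
  moreover have "\<mu> * (fact i * fact p / fact (Suc (i + p))) - \<mu> * (fact (Suc i) * fact p / fact (Suc (Suc i + p)))
      = \<mu> * (fact i * fact (Suc p) / fact (Suc (i + Suc p)))"
  proof -
    have "fact (Suc (Suc (i + p))) = (real (Suc (Suc (i + p)))) * fact (Suc (i + p))"
      by (rule fact_Suc)
    moreover have "(fact (Suc (i + p)) :: real) \<noteq> 0" by simp
    ultimately show ?thesis
      by (simp add: divide_simps del: fact_Suc of_nat_Suc) (simp add: algebra_simps)
  qed
  ultimately show ?case by (simp add: W_def)
qed

text \<open>
  Replacing \<open>b l\<close> by \<open>m * l ^ p\<close> costs only a lower order term because \<open>v\<close> is bounded, and
  reduces the claim to \<open>beta_weighted_sum\<close>.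
\<close>
lemma weighted_convolution:
  fixes v b :: "nat \<Rightarrow> real"
  assumes v: "(\<lambda>n. (\<Sum>j=1..n. v j) / n) \<longlonglongrightarrow> \<mu>" and bdd: "\<And>j. \<bar>v j\<bar> \<le> 1"
    and b: "(\<lambda>n. b n / n ^ p) \<longlonglongrightarrow> m"
  shows "(\<lambda>n. (\<Sum>j=1..n. real j ^ i * v j * b (n - j)) / n ^ Suc (i + p))
    \<longlonglongrightarrow> \<mu> * m * (fact i * fact p / fact (Suc (i + p)))"
proof -
  define d where "d l = \<bar>b l - m * real l ^ p\<bar>" for l
  have "(\<lambda>l. \<bar>b l / l ^ p - m\<bar>) \<longlonglongrightarrow> \<bar>m - m\<bar>" by (intro tendsto_intros b)
  moreover have "\<forall>\<^sub>F l in sequentially. \<bar>b l / l ^ p - m\<bar> = d l / l ^ p"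
  proof (intro eventually_sequentiallyI[of 1])
    fix l :: nat assume "l \<ge> 1"
    then have "b l / l ^ p - m = (b l - m * real l ^ p) / l ^ p" by (simp add: field_simps)
    then show "\<bar>b l / l ^ p - m\<bar> = d l / l ^ p" by (simp add: d_def abs_divide)
  qed
  ultimately have "(\<lambda>l. d l / l ^ p) \<longlonglongrightarrow> 0" by (subst (asm) tendsto_cong) auto
  from partial_sums_of_power_growth[OF this]
  have D: "(\<lambda>n. (\<Sum>l<n. d l) / n ^ Suc p) \<longlonglongrightarrow> 0" by simp
  let ?W = "\<lambda>n. m * ((\<Sum>j=1..n. real j ^ i * real (n - j) ^ p * v j) / n ^ Suc (i + p))"
  let ?B = "\<lambda>n. (\<Sum>j=1..n. real j ^ i * v j * b (n - j)) / n ^ Suc (i + p)"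
  have "(\<lambda>n. ?B n - ?W n) \<longlonglongrightarrow> 0"
  proof (rule Lim_null_comparison[OF _ D], intro eventually_sequentiallyI[of 1])
    fix n :: nat assume n: "n \<ge> 1"
    have "?B n - ?W n = (\<Sum>j=1..n. real j ^ i * v j * (b (n - j) - m * real (n - j) ^ p)) / n ^ Suc (i + p)"
      by (simp add: sum_distrib_left sum_subtractf diff_divide_distrib right_diff_distrib mult_ac)
    also have "\<bar>\<dots>\<bar> \<le> (\<Sum>j=1..n. real n ^ i * 1 * d (n - j)) / n ^ Suc (i + p)"
      unfolding abs_divide
      by (intro divide_mono order.trans[OF sum_abs] sum_mono)
         (use n bdd in \<open>auto simp: abs_mult d_def simp del: mult_1_right intro!: mult_mono power_mono sum_nonneg\<close>)
    also have "(\<Sum>j=1..n. real n ^ i * 1 * d (n - j)) = real n ^ i * (\<Sum>j=1..n. d (n - j))"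
      by (simp add: sum_distrib_left)
    also have "(\<Sum>j=1..n. d (n - j)) = (\<Sum>l<n. d l)"
      by (rule sum.reindex_bij_witness[where i = "\<lambda>l. n - l" and j = "\<lambda>j. n - j"]) auto
    also have "real n ^ i * (\<Sum>l<n. d l) / n ^ Suc (i + p) = (\<Sum>l<n. d l) / n ^ Suc p"
      using n by (simp add: power_add)
    finally show "norm (?B n - ?W n) \<le> (\<Sum>l<n. d l) / n ^ Suc p" by simp
  qed
  moreover have "?W \<longlonglongrightarrow> m * (\<mu> * (fact i * fact p / fact (Suc (i + p))))"
    by (intro tendsto_mult_left beta_weighted_sum v)
  ultimately have "(\<lambda>n. (?B n - ?W n) + ?W n) \<longlonglongrightarrow> 0 + m * (\<mu> * (fact i * fact p / fact (Suc (i + p))))"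
    by (rule tendsto_add)
  then show ?thesis by (simp add: mult_ac)
qed

text \<open>
  Coefficients of the exponential of the power series with coefficients \<open>\<mu> i / i\<close>: the
  recursion is obtained by comparing coefficients after differentiation.
\<close>
fun limit_moment :: "(nat \<Rightarrow> real) \<Rightarrow> nat \<Rightarrow> real" where
  "limit_moment \<mu> 0 = 1"
| "limit_moment \<mu> (Suc k) = (\<Sum>i\<le>k. \<mu> (Suc i) * limit_moment \<mu> (k - i)) / Suc k"

text \<open>
  In the recursion of \<open>orbit_sum_moment\<close> every inner sum is a weighted convolution. The Beta integral
  in its limit multiplied by the binomial coefficient equals \<open>1 / Suc l\<close>.
\<close>
lemma orbit_sum_moment_tendsto:
  assumes u: "\<And>i. (\<lambda>n. (\<Sum>j=1..n. u j ^ Suc i) / n) \<longlonglongrightarrow> \<mu> (Suc i)" and bdd: "\<And>j. \<bar>u j\<bar> \<le> 1"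
  shows "(\<lambda>n. orbit_sum_moment u k n / n ^ k) \<longlonglongrightarrow> limit_moment \<mu> k"
proof (induction k rule: less_induct)
  case (less k)
  show ?case
  proof (cases k)
    case (Suc l)
    let ?C = "\<lambda>i n. (\<Sum>j=1..n. real j ^ i * u j ^ Suc i * orbit_sum_moment u (l - i) (n - j)) / n ^ Suc (i + (l - i))"
    have "(\<lambda>n. \<Sum>i\<le>l. of_nat (l choose i) * ?C i n) \<longlonglongrightarrow>
        (\<Sum>i\<le>l. of_nat (l choose i) * (\<mu> (Suc i) * limit_moment \<mu> (l - i) *
          (fact i * fact (l - i) / fact (Suc (i + (l - i))))))"
      using Suc by (intro tendsto_sum tendsto_mult_left weighted_convolution u less)
        (auto simp only: power_abs intro!: power_le_one bdd abs_ge_zero)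
    also have "(\<Sum>i\<le>l. of_nat (l choose i) * (\<mu> (Suc i) * limit_moment \<mu> (l - i) *
          (fact i * fact (l - i) / fact (Suc (i + (l - i)))))) = limit_moment \<mu> k"
    proof -
      have "of_nat (l choose i) * (\<mu> (Suc i) * limit_moment \<mu> (l - i) *
          (fact i * fact (l - i) / fact (Suc (i + (l - i))))) = \<mu> (Suc i) * limit_moment \<mu> (l - i) / Suc l"
        if "i \<in> {..l}" for i
      proof -
        have "real (l choose i) * (fact i * fact (l - i)) = fact l"
          using arg_cong[OF binomial_fact_lemma[of i l], of real] that by (simp add: mult_ac)
        moreover have "fact (Suc (i + (l - i))) = real (Suc l) * fact l" using that by simp
        ultimately have "real (l choose i) * (fact i * fact (l - i) / fact (Suc (i + (l - i)))) = 1 / Suc l"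
          by (simp del: of_nat_Suc fact_Suc)
        then show ?thesis by (metis mult.left_commute mult.right_neutral times_divide_eq_right)
      qed
      then show ?thesis by (simp add: Suc sum_divide_distrib)
    qed
    also have "(\<lambda>n. \<Sum>i\<le>l. of_nat (l choose i) * ?C i n) = (\<lambda>n. orbit_sum_moment u k n / n ^ k)"
    proof
      fix n
      have "of_nat (l choose i) * ?C i n = of_nat (l choose i) *
          (\<Sum>j=1..n. real j ^ i * u j ^ Suc i * orbit_sum_moment u (l - i) (n - j)) / n ^ k"
        if "i \<in> {..l}" for i
        using that by (simp add: Suc)
      then show "(\<Sum>i\<le>l. of_nat (l choose i) * ?C i n) = orbit_sum_moment u k n / n ^ k"
        unfolding Suc orbit_sum_moment.simps sum_divide_distrib[of _ "{..l}"] by (intro sum.cong) auto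
    qed
    finally show ?thesis .
  qed simp
qed

section \<open>Equidistribution of the fractional parts\<close>

definition has_mean :: "(nat \<Rightarrow> 'a :: real_normed_field) \<Rightarrow> 'a \<Rightarrow> bool" where
  "has_mean x m \<longleftrightarrow> (\<lambda>N. (\<Sum>j=1..N. x j) / of_nat N) \<longlonglongrightarrow> m"

lemma has_mean_cmult: "has_mean x m \<Longrightarrow> has_mean (\<lambda>j. c * x j) (c * m)"
  unfolding has_mean_def by (drule tendsto_mult_left[of _ _ _ c]) (simp add: sum_distrib_left)

lemma has_mean_add: "has_mean x m \<Longrightarrow> has_mean y m' \<Longrightarrow> has_mean (\<lambda>j. x j + y j) (m + m')"
  unfolding has_mean_def by (drule (1) tendsto_add) (simp add: sum.distrib add_divide_distrib)

lemma has_mean_sum: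
  assumes "finite A" "\<And>a. a \<in> A \<Longrightarrow> has_mean (x a) (m a)"
  shows "has_mean (\<lambda>j. \<Sum>a\<in>A. x a j) (\<Sum>a\<in>A. m a)"
  using assms
proof (induction A rule: finite_induct)
  case empty
  then show ?case by (simp add: has_mean_def)
qed (auto intro: has_mean_add)

lemma has_mean_unit_powers:
  fixes w :: complex
  assumes "norm w = 1"
  shows "has_mean (\<lambda>j. w ^ j) (if w = 1 then 1 else 0)"
proof (cases "w = 1")
  case True
  have "\<forall>\<^sub>F N in sequentially. 1 = (\<Sum>j=1..N. w ^ j) / of_nat N"
    using True by (intro eventually_sequentiallyI[of 1]) simp
  then show ?thesis
    unfolding has_mean_def using True by (simp add: tendsto_eventually eventually_mono)
next
  case False
  have bound: "norm (\<Sum>j=1..N. w ^ j) \<le> 2 / norm (1 - w)" for N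
  proof -
    have "(\<Sum>j=1..N. w ^ j) = w * (\<Sum>j<N. w ^ j)"
      unfolding sum_distrib_left
      by (rule sum.reindex_bij_witness[where i = Suc and j = "\<lambda>j. j - 1"]) (auto simp flip: power_Suc)
    also have "\<dots> = w * ((1 - w ^ N) / (1 - w))" using False by (simp add: sum_gp_strict)
    also have "norm \<dots> \<le> (norm (1 :: complex) + norm (w ^ N)) / norm (1 - w)"
      unfolding norm_mult norm_divide assms mult_1_left by (intro divide_right_mono norm_triangle_ineq4) auto
    finally show ?thesis by (simp add: norm_power assms)
  qed
  have "(\<lambda>N. (\<Sum>j=1..N. w ^ j) / of_nat N) \<longlonglongrightarrow> 0"
  proof (rule Lim_null_comparison)
    show "\<forall>\<^sub>F N in sequentially. norm ((\<Sum>j=1..N. w ^ j) / of_nat N) \<le> (2 / norm (1 - w)) / real N"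
      using bound by (intro always_eventually allI) (simp only: norm_divide norm_of_nat, intro divide_right_mono, auto)
    show "(\<lambda>N. (2 / norm (1 - w)) / real N) \<longlonglongrightarrow> 0" by (rule lim_const_over_n)
  qed
  then show ?thesis using False by (simp add: has_mean_def)
qed

text \<open>
  One-periodic functions that are finite linear combinations of characters. Given inductively, so that
  statements that are linear in the function only have to be checked on characters.
\<close>
inductive trig_poly :: "(real \<Rightarrow> complex) \<Rightarrow> bool" where
  character: "trig_poly (\<lambda>x. cis (2 * pi * of_int k * x))"
| scale: "trig_poly P \<Longrightarrow> trig_poly (\<lambda>x. c * P x)"
| add: "trig_poly P \<Longrightarrow> trig_poly Q \<Longrightarrow> trig_poly (\<lambda>x. P x + Q x)"

lemma trig_poly_const: "trig_poly (\<lambda>_. c)"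
  using trig_poly.scale[OF trig_poly.character[of 0], of c] by simp

lemma trig_poly_sum: "finite A \<Longrightarrow> (\<And>a. a \<in> A \<Longrightarrow> trig_poly (P a)) \<Longrightarrow> trig_poly (\<lambda>x. \<Sum>a\<in>A. P a x)"
  by (induction A rule: finite_induct) (auto intro: trig_poly_const trig_poly.add)

lemma trig_poly_mult:
  assumes "trig_poly P" "trig_poly Q"
  shows "trig_poly (\<lambda>x. P x * Q x)"
  using assms
proof (induction P rule: trig_poly.induct)
  case (character k)
  then show ?case
  proof (induction Q rule: trig_poly.induct)
    case (character l)
    have "(\<lambda>x. cis (2 * pi * of_int k * x) * cis (2 * pi * of_int l * x)) = (\<lambda>x. cis (2 * pi * of_int (k + l) * x))"
      by (simp add: cis_mult algebra_simps)
    then show ?case using trig_poly.character by metis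
  next
    case (scale Q c)
    then show ?case by (metis (no_types, lifting) ext mult.left_commute trig_poly.scale)
  next
    case (add Q R)
    then show ?case using trig_poly.add by (simp add: distrib_left)
  qed
next
  case (scale P c)
  then show ?case using trig_poly.scale by (simp add: mult.assoc)
next
  case (add P R)
  then show ?case using trig_poly.add by (simp add: distrib_right)
qed

lemma trig_poly_power: "trig_poly P \<Longrightarrow> trig_poly (\<lambda>x. P x ^ n)"
  by (induction n) (auto intro: trig_poly_const trig_poly_mult)

lemma continuous_on_trig_poly: "trig_poly P \<Longrightarrow> continuous_on A P"
  by (induction rule: trig_poly.induct) (auto intro!: continuous_intros simp: cis_conv_exp)

lemma integrable_trig_poly: "trig_poly P \<Longrightarrow> P integrable_on {0..1}"
  by (intro integrable_continuous_interval continuous_on_trig_poly)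

lemma integral_character: "integral {0..1} (\<lambda>x. cis (2 * pi * of_int k * x)) = (if k = 0 then 1 else 0)"
proof (cases "k = 0")
  case False
  define c where "c = \<i> * of_real (2 * pi * of_int k)"
  have "c \<noteq> 0" using False by (simp add: c_def)
  have cis: "cis (2 * pi * of_int k * x) = exp (c * of_real x)" for x
    by (simp add: cis_conv_exp c_def mult_ac)
  have "((\<lambda>x. exp (c * of_real x)) has_integral (exp (c * of_real 1) / c - exp (c * of_real 0) / c)) {0..1}"
  proof (rule fundamental_theorem_of_calculus)
    fix x :: real
    have "((\<lambda>z. exp (c * z) / c) has_field_derivative exp (c * of_real x)) (at (of_real x) within S)" for S
      using \<open>c \<noteq> 0\<close> by (auto intro!: derivative_eq_intros)
    then have "((\<lambda>x. exp (c * of_real x) / c) has_vector_derivative exp (c * of_real x)) (at x)"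
      by (rule has_vector_derivative_real_field)
    then show "((\<lambda>x. exp (c * of_real x) / c) has_vector_derivative exp (c * of_real x)) (at x within {0..1})"
      by (rule has_vector_derivative_at_within)
  qed simp
  moreover have "exp (c * of_real 1) = 1"
    using cis[of 1] False cis_multiple_2pi[of "of_int k"] by simp
  ultimately show ?thesis using False by (simp add: cis integral_unique)
qed simp

text \<open>
  Weyl's criterion. Both sides are bilinear in \<open>P\<close> and \<open>Q\<close>. For two characters the left-hand side averages
  the powers of a number on the unit circle, and independence says that this number is 1 only
  for two trivial characters.
\<close>
lemma has_mean_trig_poly_product:
  assumes indep: "\<And>k l. of_int k * \<alpha> + of_int l * \<beta> \<in> \<int> \<Longrightarrow> k = 0 \<and> l = 0"
    and "trig_poly P" "trig_poly Q"
  shows "has_mean (\<lambda>j. P (j * \<alpha>) * Q (j * \<beta>)) (integral {0..1} P * integral {0..1} Q)"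
  using assms(2,3)
proof (induction P rule: trig_poly.induct)
  case (character k)
  then show ?case
  proof (induction Q rule: trig_poly.induct)
    case (character l)
    let ?w = "cis (2 * pi * (of_int k * \<alpha> + of_int l * \<beta>))"
    have pow: "cis (2 * pi * of_int k * (j * \<alpha>)) * cis (2 * pi * of_int l * (j * \<beta>)) = ?w ^ j" for j :: nat
      by (simp add: cis_mult Complex.DeMoivre algebra_simps)
    have "?w = 1 \<longleftrightarrow> k = 0 \<and> l = 0"
    proof
      assume "?w = 1"
      then have "cos (2 * pi * (of_int k * \<alpha> + of_int l * \<beta>)) = 1" by (simp add: complex_eq_iff)
      then obtain n :: int where "2 * pi * (of_int k * \<alpha> + of_int l * \<beta>) = of_int n * 2 * pi"
        using cos_one_2pi_int by auto
      then have "of_int k * \<alpha> + of_int l * \<beta> = of_int n" by simp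
      then show "k = 0 \<and> l = 0" using indep[of k l] by (simp only: Ints_of_int simp_thms)
    qed simp
    then show ?case
      using has_mean_unit_powers[of ?w] unfolding pow integral_character
      by (cases "k = 0"; cases "l = 0") simp_all
  next
    case (scale Q c)
    then show ?case using has_mean_cmult[OF scale.IH, of c] by (simp add: mult_ac integral_mult_right)
  next
    case (add Q R)
    then show ?case using has_mean_add[OF add.IH] integrable_trig_poly
      by (simp add: distrib_left integral_add)
  qed
next
  case (scale P c)
  then show ?case using has_mean_cmult[OF scale.IH[OF scale.prems], of c] by (simp add: mult_ac integral_mult_right)
next
  case (add P R)
  then show ?case using has_mean_add[OF add.IH(1)[OF add.prems] add.IH(2)[OF add.prems]] integrable_trig_poly
    by (simp add: distrib_right integral_add)
qed

text \<open>
  The chord from \<open>cis \<phi>\<close> to 1 has direction \<open>(\<phi> - pi) / 2\<close>. This is the sawtooth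
  Fourier series in closed form, and the source of the trigonometric approximations of \<open>frac\<close>.
\<close>
lemma Im_Ln_one_minus_cis:
  assumes "frac x \<noteq> 0"
  shows "Im (Ln (1 - cis (2 * pi * x))) = pi * (frac x - 1 / 2)"
proof -
  define t where "t = frac x"
  have t: "0 < t" "t < 1" using assms frac_ge_0[of x] frac_lt_1[of x] unfolding t_def by linarith+
  have "x = t + of_int \<lfloor>x\<rfloor>" by (simp add: t_def frac_def)
  then have "cis (2 * pi * x) = cis (2 * pi * t) * cis (2 * pi * of_int \<lfloor>x\<rfloor>)"
    by (metis cis_mult distrib_left)
  then have x: "cis (2 * pi * x) = cis (2 * pi * t)" by (simp add: cis_multiple_2pi)
  have s: "sin (pi * t) > 0" using t by (intro sin_gt_zero) auto
  have "1 - cis (2 * pi * t) = of_real (2 * sin (pi * t)) * cis (pi * (t - 1 / 2))"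
  proof -
    have "cos (2 * (pi * t)) = 1 - 2 * sin (pi * t) * sin (pi * t)"
      by (simp add: cos_double_sin power2_eq_square)
    moreover have "sin (2 * (pi * t)) = 2 * sin (pi * t) * cos (pi * t)" by (rule sin_double)
    moreover have "cos (pi * (t - 1 / 2)) = sin (pi * t)" "sin (pi * (t - 1 / 2)) = - cos (pi * t)"
      by (simp_all add: right_diff_distrib cos_diff sin_diff)
    ultimately show ?thesis by (simp add: complex_eq_iff mult.assoc)
  qed
  also have "\<dots> = exp (of_real (ln (2 * sin (pi * t))) + \<i> * of_real (pi * (t - 1 / 2)))"
    using s by (simp add: exp_add exp_of_real cis_conv_exp del: of_real_mult)
  finally have "Ln (1 - cis (2 * pi * t)) = of_real (ln (2 * sin (pi * t))) + \<i> * of_real (pi * (t - 1 / 2))"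
  proof (intro Ln_unique)
    have "pi * (- 1) < pi * (t - 1 / 2)" "pi * (t - 1 / 2) \<le> pi * 1"
      using t by (intro mult_strict_left_mono mult_left_mono; simp)+
    then show "- pi < Im (of_real (ln (2 * sin (pi * t))) + \<i> * of_real (pi * (t - 1 / 2)))"
      "Im (of_real (ln (2 * sin (pi * t))) + \<i> * of_real (pi * (t - 1 / 2))) \<le> pi" by simp_all
  qed simp
  then show ?thesis unfolding x by (simp add: t_def)
qed

lemma Re_one_minus_cmult_pos:
  assumes "norm z = 1" "z \<noteq> 1" "0 \<le> s" "s \<le> 1"
  shows "Re (1 - of_real s * z) > 0"
proof -
  have "Re z \<noteq> 1"
  proof
    assume "Re z = 1"
    then have "Im z = 0" using assms(1) cmod_power2[of z] by simp
    then show False using \<open>Re z = 1\<close> assms(2) by (simp add: complex_eq_iff)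
  qed
  then have "Re z < 1" using assms(1) complex_Re_le_cmod[of z] by simp
  moreover have "s * Re z \<le> max 0 (Re z)"
    using assms(3,4) by (cases "Re z \<ge> 0") (auto simp: mult_left_le_one_le mult_nonneg_nonpos)
  ultimately show ?thesis by simp
qed

text \<open>
  Along the segment from \<open>1 - r * z\<close> to \<open>1 - z\<close> the distance to the singularity 0 of the
  logarithm is at least half of its value at the end point.
\<close>
lemma norm_Ln_radial_diff_le:
  assumes "norm z = 1" "z \<noteq> 1" "0 \<le> r" "r \<le> 1"
  shows "norm (Ln (1 - of_real r * z) - Ln (1 - z)) \<le> 2 / norm (1 - z) * (1 - r)"
proof -
  let ?S = "closed_segment (1 - of_real r * z) (1 - z)"
  have "norm (Ln (1 - of_real r * z) - Ln (1 - z)) \<le>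
      2 / norm (1 - z) * norm ((1 - of_real r * z) - (1 - z))"
  proof (rule field_differentiable_bound[where S = ?S and f' = "\<lambda>w. inverse w"])
    fix w assume "w \<in> ?S"
    then obtain v where v: "0 \<le> v" "v \<le> 1" "w = (1 - v) *\<^sub>R (1 - of_real r * z) + v *\<^sub>R (1 - z)"
      by (auto simp: closed_segment_def)
    define s where "s = (1 - v) * r + v"
    have w: "w = 1 - of_real s * z" using v by (simp add: s_def scaleR_conv_of_real algebra_simps)
    have s: "0 \<le> s" using v assms by (simp add: s_def)
    have "(1 - v) * r \<le> (1 - v) * 1" by (rule mult_left_mono) (use v assms in auto)
    then have s1: "s \<le> 1" by (simp add: s_def)
    have "Re w > 0" unfolding w by (rule Re_one_minus_cmult_pos[OF assms(1,2) s s1])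
    then have "w \<notin> \<real>\<^sub>\<le>\<^sub>0" by (auto simp: complex_nonpos_Reals_iff)
    then show "(Ln has_field_derivative inverse w) (at w within ?S)"
      by (auto intro!: derivative_eq_intros simp: divide_inverse)
    have "norm (1 - z) \<le> norm w + norm (of_real (1 - s) * z)"
      using norm_triangle_ineq4[of w "of_real (1 - s) * z"] by (simp add: w algebra_simps)
    also have "norm (of_real (1 - s) * z) = 1 - s"
      unfolding norm_mult norm_of_real assms(1) using s1 by simp
    also have "1 - s \<le> norm w"
      using norm_triangle_ineq2[of 1 "of_real s * z"] s assms(1) by (simp add: w norm_mult)
    finally have "norm (1 - z) \<le> 2 * norm w" by simp
    moreover have "norm w > 0" "norm (1 - z) > 0" using \<open>Re w > 0\<close> assms(2) by auto
    ultimately have "inverse (norm w) \<le> 2 / norm (1 - z)" by (simp add: field_simps)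
    then show "norm (inverse w) \<le> 2 / norm (1 - z)" by (simp only: norm_inverse)
  qed auto
  also have "norm ((1 - of_real r * z) - (1 - z)) = 1 - r"
  proof -
    have "(1 - of_real r * z) - (1 - z) = of_real (1 - r) * z" by (simp add: algebra_simps)
    then show ?thesis using assms(4) by (simp only: norm_mult norm_of_real assms(1)) simp
  qed
  finally show ?thesis .
qed

lemma norm_Ln_partial_sum_diff_le:
  assumes "norm z \<le> r" "r < 1"
  shows "norm (Ln (1 - z) - (\<Sum>n<K. - (z ^ n) / of_nat n)) \<le> r ^ K / (1 - r)"
proof -
  have r: "0 \<le> r" using assms(1) norm_ge_zero order_trans by blast
  have sums: "(\<lambda>n. - (z ^ n) / of_nat n) sums Ln (1 - z)"
    using Ln_series'[of "- z"] assms by simp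
  have le: "norm (- (z ^ (n + K)) / of_nat (n + K)) \<le> r ^ K * r ^ n" for n
  proof (cases "n + K = 0")
    case False
    have "norm (- (z ^ (n + K)) / of_nat (n + K)) = norm z ^ (n + K) / real (n + K)"
      by (simp only: norm_divide norm_minus_cancel norm_power norm_of_nat)
    also have "\<dots> \<le> norm z ^ (n + K) / 1"
      using False by (intro divide_left_mono) auto
    also have "\<dots> \<le> r ^ (n + K)" using assms by (simp add: power_mono)
    finally show ?thesis by (simp add: power_add mult.commute)
  qed (use r in simp)
  have "Ln (1 - z) - (\<Sum>n<K. - (z ^ n) / of_nat n) = (\<Sum>n. - (z ^ (n + K)) / of_nat (n + K))"
    using suminf_minus_initial_segment[OF sums_summable[OF sums], of K] sums_unique[OF sums] by simp
  also have "norm \<dots> \<le> (\<Sum>n. r ^ K * r ^ n)"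
    by (rule norm_suminf_le[OF le]) (use assms r in \<open>auto intro: summable_mult summable_geometric\<close>)
  also have "\<dots> = r ^ K / (1 - r)"
    using assms r by (simp add: suminf_mult suminf_geometric)
  finally show ?thesis .
qed

text \<open>
  By \<open>Im_Ln_one_minus_cis\<close> the function \<open>frac\<close> is an affine image of the argument of \<open>1 - cis (2 * pi * x)\<close>.
  Moving the point inside the disc, to radius \<open>r < 1\<close>, changes this little away from
  integers, and on that circle the logarithmic series converges uniformly, so that a partial sum is a
  trigonometric polynomial of the required kind. Near integers only boundedness survives, as
  \<open>frac\<close> jumps.
\<close>
lemma trig_poly_approximates_frac:
  assumes "\<epsilon> > 0"
  shows "\<exists>P. trig_poly P \<and> (\<forall>x. norm (P x) \<le> 2 \<and>
    (\<epsilon> \<le> frac x \<and> frac x \<le> 1 - \<epsilon> \<longrightarrow> norm (P x - of_real (frac x)) \<le> \<epsilon>))"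
proof (cases "\<epsilon> \<le> 1 / 2")
  case False
  then show ?thesis by (intro exI[of _ "\<lambda>_. 0"]) (auto intro: trig_poly_const)
next
  case True
  define d where "d = 2 * sin (pi * \<epsilon>)"
  have "d > 0" unfolding d_def using assms True by (intro mult_pos_pos sin_gt_zero) auto
  \<comment> \<open>\<open>d\<close> bounds \<open>norm (1 - cis (2 * pi * x))\<close> from below on the good set; \<open>r\<close> makes the radial error at most \<open>\<epsilon> / 2\<close>\<close>
  define r where "r = max (1 / 2) (1 - d * \<epsilon> / 4)"
  have r: "1 / 2 \<le> r" "r < 1" using \<open>d > 0\<close> assms by (auto simp: r_def)
  have rd: "2 / d * (1 - r) \<le> \<epsilon> / 2" using \<open>d > 0\<close> by (simp add: r_def max_def field_simps)
  have "(\<lambda>K. r ^ K / (1 - r)) \<longlonglongrightarrow> 0 / (1 - r)"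
    using r by (intro tendsto_divide LIMSEQ_power_zero tendsto_const) auto
  then have "\<forall>\<^sub>F K in sequentially. r ^ K / (1 - r) < \<epsilon> / 2"
    using assms by (intro order_tendstoD(2)[where y = 0]) auto
  then obtain K where K: "r ^ K / (1 - r) < \<epsilon> / 2" by (auto simp: eventually_sequentially)
  define T where "T x = (\<Sum>n<K. - ((of_real r * cis (2 * pi * x)) ^ n) / of_nat n)" for x
  define P :: "real \<Rightarrow> complex" where "P x = of_real (1 / 2 + Im (T x) / pi)" for x
  have "trig_poly P"
  proof -
    have "P = (\<lambda>x. 1 / 2 + (\<Sum>n<K. \<i> * of_real (r ^ n / (2 * pi * real n)) * cis (2 * pi * of_int (int n) * x) +
        - \<i> * of_real (r ^ n / (2 * pi * real n)) * cis (2 * pi * of_int (- int n) * x)))"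
    proof
      fix x
      have "of_real (Im (- ((of_real r * cis (2 * pi * x)) ^ n) / of_nat n) / pi) =
          \<i> * of_real (r ^ n / (2 * pi * real n)) * cis (2 * pi * of_int (int n) * x) +
          - \<i> * of_real (r ^ n / (2 * pi * real n)) * cis (2 * pi * of_int (- int n) * x)" for n
      proof -
        have "(of_real r * cis (2 * pi * x)) ^ n = of_real (r ^ n) * cis (2 * pi * n * x)"
          by (simp add: power_mult_distrib Complex.DeMoivre mult_ac)
        moreover have "Im (- (of_real (r ^ n) * cis (2 * pi * n * x)) / of_nat n) = - (r ^ n * sin (2 * pi * n * x) / n)"
          by (simp add: Im_divide_of_nat)
        ultimately show ?thesis by (simp add: complex_eq_iff field_simps)
      qed
      then show "P x = 1 / 2 + (\<Sum>n<K. \<i> * of_real (r ^ n / (2 * pi * real n)) * cis (2 * pi * of_int (int n) * x) +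
        - \<i> * of_real (r ^ n / (2 * pi * real n)) * cis (2 * pi * of_int (- int n) * x))"
        by (simp only: P_def T_def Im_sum sum_divide_distrib of_real_add of_real_sum) simp
    qed
    moreover have "trig_poly \<dots>"
      by (intro trig_poly.add trig_poly_const trig_poly_sum trig_poly.scale trig_poly.character finite_lessThan)
    ultimately show ?thesis by simp
  qed
  have close: "norm (P x - of_real (1 / 2 + Im (Ln (1 - of_real r * cis (2 * pi * x))) / pi)) \<le> \<epsilon> / 2" for x
  proof -
    have "norm (Ln (1 - of_real r * cis (2 * pi * x)) - T x) \<le> \<epsilon> / 2"
      using norm_Ln_partial_sum_diff_le[of "of_real r * cis (2 * pi * x)" r K] r K
      unfolding T_def norm_mult norm_of_real norm_cis by linarith
    then have "\<bar>Im (Ln (1 - of_real r * cis (2 * pi * x)) - T x)\<bar> \<le> \<epsilon> / 2"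
      using abs_Im_le_cmod order_trans by blast
    moreover have "norm (P x - of_real (1 / 2 + Im (Ln (1 - of_real r * cis (2 * pi * x))) / pi)) =
        \<bar>Im (Ln (1 - of_real r * cis (2 * pi * x)) - T x)\<bar> / pi"
    proof -
      have "P x - of_real (1 / 2 + Im (Ln (1 - of_real r * cis (2 * pi * x))) / pi) =
          of_real (- (Im (Ln (1 - of_real r * cis (2 * pi * x)) - T x) / pi))"
        by (simp add: P_def diff_divide_distrib)
      then show ?thesis by (simp only: norm_of_real abs_minus_cancel abs_divide) simp
    qed
    moreover have "\<bar>y\<bar> / pi \<le> \<bar>y\<bar>" for y using pi_ge_two mult_right_mono[of 1 pi "\<bar>y\<bar>"] by (simp add: field_simps)
    ultimately show ?thesis by (metis order_trans)
  qed
  have "norm (P x) \<le> 2" for x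
  proof -
    have "norm (of_real r * cis (2 * pi * x)) < 1" using r by (simp add: norm_mult)
    then have "Re (1 - of_real r * cis (2 * pi * x)) > 0"
      using complex_Re_le_cmod[of "of_real r * cis (2 * pi * x)"] by simp
    then have "\<bar>Im (Ln (1 - of_real r * cis (2 * pi * x)))\<bar> < pi / 2"
      using Re_Ln_pos_lt_imp by blast
    then have "\<bar>Im (Ln (1 - of_real r * cis (2 * pi * x))) / pi\<bar> < 1 / 2" by (simp add: abs_divide field_simps)
    then have "norm (of_real (1 / 2 + Im (Ln (1 - of_real r * cis (2 * pi * x))) / pi) :: complex) \<le> 1"
      unfolding norm_of_real by linarith
    moreover note close[of x]
      norm_triangle_sub[of "P x" "of_real (1 / 2 + Im (Ln (1 - of_real r * cis (2 * pi * x))) / pi)"]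
    ultimately show ?thesis using True by linarith
  qed
  moreover have "norm (P x - of_real (frac x)) \<le> \<epsilon>" if x: "\<epsilon> \<le> frac x" "frac x \<le> 1 - \<epsilon>" for x
  proof -
    let ?z = "cis (2 * pi * x)"
    have "frac x \<noteq> 0" using x(1) assms by linarith
    have im: "Im (Ln (1 - ?z)) = pi * (frac x - 1 / 2)" by (rule Im_Ln_one_minus_cis[OF \<open>frac x \<noteq> 0\<close>])
    have nz: "norm (1 - ?z) \<ge> d"
    proof -
      have "sin (pi * x) ^ 2 = sin (pi * frac x) ^ 2"
      proof -
        have "pi * x = pi * frac x + of_int \<lfloor>x\<rfloor> * pi" by (simp add: frac_def algebra_simps)
        then have "cos (2 * (pi * x)) = cos (2 * (pi * frac x) + 2 * pi * of_int \<lfloor>x\<rfloor>)" by (simp add: algebra_simps)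
        also have "\<dots> = cos (2 * (pi * frac x))" by (simp add: cos_add sin_int_2pin cos_int_2pin)
        finally show ?thesis by (simp add: cos_double_sin)
      qed
      moreover have "norm (1 - ?z) ^ 2 = (2 * sin (pi * x)) ^ 2"
      proof -
        have "norm (1 - ?z) ^ 2 = (1 - cos (2 * pi * x)) ^ 2 + sin (2 * pi * x) ^ 2"
          by (simp add: cmod_power2)
        also have "\<dots> = 2 - 2 * cos (2 * (pi * x))"
          using sin_cos_squared_add[of "2 * (pi * x)"] by (simp add: power2_eq_square algebra_simps)
        also have "\<dots> = (2 * sin (pi * x)) ^ 2" by (simp add: cos_double_sin power2_eq_square)
        finally show ?thesis .
      qed
      ultimately have "norm (1 - ?z) ^ 2 = (2 * sin (pi * frac x)) ^ 2" by (simp add: power_mult_distrib)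
      moreover have "sin (pi * frac x) \<ge> sin (pi * \<epsilon>)"
      proof (cases "frac x \<le> 1 / 2")
        case le: True
        have "pi * \<epsilon> \<ge> 0" "pi * frac x \<le> pi * (1 / 2)" "pi * \<epsilon> \<le> pi * frac x"
          using x assms le by (auto intro!: mult_left_mono)
        then show ?thesis using pi_gt_zero by (intro sin_monotone_2pi_le) linarith+
      next
        case False
        have "sin (pi * frac x) = sin (pi * (1 - frac x))" by (simp add: right_diff_distrib sin_diff)
        moreover have "sin (pi * (1 - frac x)) \<ge> sin (pi * \<epsilon>)"
        proof -
          have "pi * \<epsilon> \<ge> 0" "pi * (1 - frac x) \<le> pi * (1 / 2)" "pi * \<epsilon> \<le> pi * (1 - frac x)"
            using x assms False by (auto intro!: mult_left_mono)
          then show ?thesis using pi_gt_zero by (intro sin_monotone_2pi_le) linarith+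
        qed
        ultimately show ?thesis by simp
      qed
      ultimately have "d ^ 2 \<le> norm (1 - ?z) ^ 2"
        using \<open>d > 0\<close> unfolding d_def by (simp add: power_mono)
      then show ?thesis by (rule power2_le_imp_le) simp
    qed
    have "?z \<noteq> 1" using nz \<open>d > 0\<close> by (metis diff_self norm_zero not_le)
    then have "norm (Ln (1 - of_real r * ?z) - Ln (1 - ?z)) \<le> 2 / norm (1 - ?z) * (1 - r)"
      using norm_Ln_radial_diff_le[of ?z r] r by simp
    also have "\<dots> \<le> 2 / d * (1 - r)"
      using nz \<open>d > 0\<close> r mult_pos_pos[OF less_le_trans[OF \<open>d > 0\<close> nz] \<open>d > 0\<close>]
      by (intro mult_right_mono divide_left_mono) auto
    also have "\<dots> \<le> \<epsilon> / 2" by (rule rd)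
    finally have "\<bar>Im (Ln (1 - of_real r * ?z) - Ln (1 - ?z))\<bar> \<le> \<epsilon> / 2"
      using abs_Im_le_cmod order_trans by blast
    then have "\<bar>Im (Ln (1 - of_real r * ?z)) - pi * (frac x - 1 / 2)\<bar> / pi \<le> \<epsilon> / 2 / pi"
      using im by (intro divide_right_mono) auto
    also have "\<epsilon> / 2 / pi \<le> \<epsilon> / 2" using pi_ge_two assms by (simp add: field_simps)
    also have "\<bar>Im (Ln (1 - of_real r * ?z)) - pi * (frac x - 1 / 2)\<bar> / pi =
        \<bar>(1 / 2 + Im (Ln (1 - of_real r * ?z)) / pi) - frac x\<bar>"
    proof -
      have "(1 / 2 + Im (Ln (1 - of_real r * ?z)) / pi) - frac x =
          (Im (Ln (1 - of_real r * ?z)) - pi * (frac x - 1 / 2)) / pi" by (simp add: field_simps)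
      then show ?thesis by simp
    qed
    also have "\<dots> = norm (of_real (1 / 2 + Im (Ln (1 - of_real r * ?z)) / pi) - of_real (frac x) :: complex)"
      by (simp only: of_real_diff[symmetric] norm_of_real)
    finally show ?thesis using close[of x] norm_triangle_le[of "P x - of_real (1 / 2 + Im (Ln (1 - of_real r * ?z)) / pi)"
        "of_real (1 / 2 + Im (Ln (1 - of_real r * ?z)) / pi) - of_real (frac x)" \<epsilon>] by simp
  qed
  ultimately show ?thesis using \<open>trig_poly P\<close> by blast
qed

text \<open>
  Two indices \<open>j < j'\<close> with \<open>j * \<alpha>\<close> and \<open>j' * \<alpha>\<close> both close to integers make \<open>(j' - j) * \<alpha>\<close>
  close to an integer. For irrational \<open>\<alpha>\<close> the finitely many multiples \<open>h * \<alpha>\<close> with \<open>0 < h < H\<close> stay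
  away from the integers, so any two such indices are at least \<open>H\<close> apart.
\<close>
lemma near_integer_sparse:
  fixes \<alpha> :: real
  assumes "\<alpha> \<notin> \<rat>" "H \<ge> 1"
  shows "\<exists>\<epsilon>>0. \<forall>N. card {j \<in> {1..N::nat}. frac (real j * \<alpha>) < \<epsilon> \<or> frac (real j * \<alpha>) > 1 - \<epsilon>} * H \<le> N + H"
proof -
  have frac_pos: "frac (real h * \<alpha>) > 0" if "h \<ge> 1" for h :: nat
  proof -
    have "h * \<alpha> \<notin> \<int>"
    proof
      assume "h * \<alpha> \<in> \<int>"
      then have "(h * \<alpha>) / h \<in> \<rat>" using Ints_subset_Rats by (intro Rats_divide) auto
      then show False using assms(1) that by simp
    qed
    then show ?thesis by simp
  qed
  have "\<exists>\<epsilon>>0. \<forall>h\<in>{1..<H}. 2 * \<epsilon> \<le> frac (real h * \<alpha>) \<and> frac (real h * \<alpha>) \<le> 1 - 2 * \<epsilon>"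
  proof -
    \<comment> \<open>the additional element 1 covers the case \<open>H = 1\<close>\<close>
    define F where "F = insert 1 ((\<lambda>h. min (frac (real h * \<alpha>)) (1 - frac (real h * \<alpha>))) ` {1..<H})"
    have F: "finite F" "F \<noteq> {}" by (auto simp: F_def)
    have "Min F > 0" using F frac_pos frac_lt_1 by (auto simp: F_def Min_gr_iff)
    moreover have "2 * (Min F / 2) \<le> frac (real h * \<alpha>) \<and> frac (real h * \<alpha>) \<le> 1 - 2 * (Min F / 2)" if "h \<in> {1..<H}" for h
    proof -
      have "min (frac (real h * \<alpha>)) (1 - frac (real h * \<alpha>)) \<in> F" using that by (simp add: F_def)
      then have "Min F \<le> min (frac (real h * \<alpha>)) (1 - frac (real h * \<alpha>))" by (rule Min_le[OF F(1)])
      then show ?thesis by simp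
    qed
    ultimately show ?thesis by (intro exI[of _ "Min F / 2"]) auto
  qed
  then obtain \<epsilon> where \<epsilon>: "\<epsilon> > 0"
    and gap: "\<And>h. h \<in> {1..<H} \<Longrightarrow> 2 * \<epsilon> \<le> frac (real h * \<alpha>) \<and> frac (real h * \<alpha>) \<le> 1 - 2 * \<epsilon>" by blast
  define bad where "bad j \<longleftrightarrow> frac (real j * \<alpha>) < \<epsilon> \<or> frac (real j * \<alpha>) > 1 - \<epsilon>" for j
  have separated: "False" if bad: "bad j" "bad j'" and j: "j < j'" "j' < j + H" for j j'
  proof -
    have near: "\<exists>m::int. \<bar>real i * \<alpha> - m\<bar> < \<epsilon>" if "bad i" for i
    proof (cases "frac (real i * \<alpha>) < \<epsilon>")
      case True
      then show ?thesis using frac_ge_0[of "real i * \<alpha>"]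
        by (intro exI[of _ "\<lfloor>real i * \<alpha>\<rfloor>"]) (simp add: frac_def)
    next
      case False
      then have "frac (real i * \<alpha>) > 1 - \<epsilon>" using that by (simp add: bad_def)
      then show ?thesis using frac_lt_1[of "real i * \<alpha>"]
        by (intro exI[of _ "\<lfloor>real i * \<alpha>\<rfloor> + 1"]) (simp add: frac_def)
    qed
    obtain m m' :: int where m: "\<bar>real j * \<alpha> - m\<bar> < \<epsilon>" "\<bar>real j' * \<alpha> - m'\<bar> < \<epsilon>"
      using near bad by metis
    define h where "h = j' - j"
    have h: "h \<in> {1..<H}" "real h * \<alpha> = real j' * \<alpha> - real j * \<alpha>"
      using j by (auto simp: h_def of_nat_diff algebra_simps)
    have "\<bar>real h * \<alpha> - of_int (m' - m)\<bar> < 2 * \<epsilon>" using m by (simp add: h(2))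
    then have near: "\<bar>frac (real h * \<alpha>) + of_int (\<lfloor>real h * \<alpha>\<rfloor> - (m' - m))\<bar> < 2 * \<epsilon>"
      by (simp add: frac_def)
    define k where "k = \<lfloor>real h * \<alpha>\<rfloor> - (m' - m)"
    consider "k \<ge> 0" | "k \<le> -1" by linarith
    then show False
    proof cases
      case 1
      then have "real_of_int k \<ge> 0" by simp
      then show False using near gap[OF h(1)] unfolding k_def[symmetric] by linarith
    next
      case 2
      then have "real_of_int k \<le> -1" by linarith
      then show False using near gap[OF h(1)] unfolding k_def[symmetric] by linarith
    qed
  qed
  have "card {j \<in> {1..N}. bad j} * H \<le> N + H" for N
  proof -
    have "card (\<Union>j\<in>{j \<in> {1..N}. bad j}. {j..<j + H}) = (\<Sum>j\<in>{j \<in> {1..N}. bad j}. card {j..<j + H})"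
    proof (rule card_UN_disjoint)
      show "\<forall>i\<in>{j \<in> {1..N}. bad j}. \<forall>j\<in>{j \<in> {1..N}. bad j}. i \<noteq> j \<longrightarrow> {i..<i + H} \<inter> {j..<j + H} = {}"
      proof (intro ballI impI)
        fix i j assume "i \<in> {j \<in> {1..N}. bad j}" "j \<in> {j \<in> {1..N}. bad j}" "i \<noteq> j"
        then have "\<not> (i < j \<and> j < i + H)" "\<not> (j < i \<and> i < j + H)" "i \<noteq> j" using separated by blast+
        then show "{i..<i + H} \<inter> {j..<j + H} = {}" by auto
      qed
    qed auto
    moreover have "card (\<Union>j\<in>{j \<in> {1..N}. bad j}. {j..<j + H}) \<le> card {0..<N + H}"
      by (intro card_mono) auto
    ultimately show ?thesis by simp
  qed
  then show ?thesis unfolding bad_def using \<epsilon> by blast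
qed

lemma near_integer_frequency:
  fixes \<alpha> :: real
  assumes "\<alpha> \<notin> \<rat>" "\<delta> > 0"
  shows "\<exists>\<epsilon>0>0. \<forall>\<epsilon>\<le>\<epsilon>0. \<forall>\<^sub>F N in sequentially.
    card {j \<in> {1..N::nat}. frac (real j * \<alpha>) < \<epsilon> \<or> frac (real j * \<alpha>) > 1 - \<epsilon>} / N \<le> \<delta>"
proof -
  obtain H :: nat where H: "2 / \<delta> < real H" using reals_Archimedean2 by blast
  then have "real H > 0" using assms(2) by (meson divide_pos_pos order_less_trans zero_less_numeral)
  then have "H \<ge> 1" by simp
  obtain \<epsilon>0 where \<epsilon>0: "\<epsilon>0 > 0"
    "\<And>N. card {j \<in> {1..N::nat}. frac (real j * \<alpha>) < \<epsilon>0 \<or> frac (real j * \<alpha>) > 1 - \<epsilon>0} * H \<le> N + H"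
    using near_integer_sparse[OF assms(1) \<open>H \<ge> 1\<close>] by blast
  have "\<forall>\<^sub>F N in sequentially. card {j \<in> {1..N::nat}. frac (real j * \<alpha>) < \<epsilon> \<or> frac (real j * \<alpha>) > 1 - \<epsilon>} / N \<le> \<delta>"
    if "\<epsilon> \<le> \<epsilon>0" for \<epsilon>
  proof (intro eventually_sequentiallyI[of H])
    fix N assume N: "N \<ge> H"
    let ?c = "card {j \<in> {1..N::nat}. frac (real j * \<alpha>) < \<epsilon> \<or> frac (real j * \<alpha>) > 1 - \<epsilon>}"
    have "?c \<le> card {j \<in> {1..N::nat}. frac (real j * \<alpha>) < \<epsilon>0 \<or> frac (real j * \<alpha>) > 1 - \<epsilon>0}"
      using that by (intro card_mono) auto
    then have "?c * H \<le> N + H" by (rule order_trans[OF mult_le_mono1 \<epsilon>0(2)])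
    then have "real ?c * real H \<le> real N + real H"
      unfolding of_nat_mult[symmetric] of_nat_add[symmetric] of_nat_le_iff .
    then have "real ?c * real H \<le> 2 * real N" using N by simp
    then have "real ?c / N \<le> 2 / H" using \<open>real H > 0\<close> N by (simp add: field_simps)
    also have "\<dots> \<le> \<delta>" using H assms(2) \<open>real H > 0\<close> by (simp add: field_simps)
    finally show "real ?c / N \<le> \<delta>" .
  qed
  then show ?thesis using \<epsilon>0(1) by blast
qed

lemma norm_power_diff_le_bounded:
  fixes z w :: complex
  assumes "norm z \<le> 2" "norm w \<le> 2"
  shows "norm (z ^ a - w ^ a) \<le> real a * 2 ^ a * norm (z - w)"
proof -
  have "norm ((z / 2) ^ a - (w / 2) ^ a) \<le> a * norm (z / 2 - w / 2)"
    using assms by (intro norm_power_diff) (auto simp: norm_divide)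
  moreover have "(z / 2) ^ a - (w / 2) ^ a = (z ^ a - w ^ a) / 2 ^ a"
    by (simp add: power_divide diff_divide_distrib)
  moreover have "z / 2 - w / 2 = (z - w) / 2" by (simp add: diff_divide_distrib)
  ultimately have "norm (z ^ a - w ^ a) \<le> 2 ^ a * (a * (norm (z - w) / 2))"
    by (simp add: norm_divide norm_power field_simps)
  also have "\<dots> \<le> 2 ^ a * (a * norm (z - w))" by (intro mult_left_mono) auto
  finally show ?thesis by (simp add: mult_ac)
qed

text \<open>
  Quantitative closeness of the powers of \<open>P\<close> and \<open>frac\<close>, once pointwise, with a bounded error on the
  exceptional set near the integers, and once for the integrals over a period, where the exceptional set
  has length \<open>2 * \<epsilon>\<close>.
\<close>
lemma trig_poly_approximates_frac_power:
  fixes a :: nat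
  assumes "trig_poly P" "\<And>x. norm (P x) \<le> 2" "0 < \<epsilon>" "\<epsilon> \<le> 1 / 2"
    and close: "\<And>x. \<epsilon> \<le> frac x \<Longrightarrow> frac x \<le> 1 - \<epsilon> \<Longrightarrow> norm (P x - of_real (frac x)) \<le> \<epsilon>"
  defines "K \<equiv> real a * 2 ^ a + 2 ^ a + 1"
  shows "norm (of_real (frac x ^ a) - P x ^ a) \<le> K * (\<epsilon> + of_bool (frac x < \<epsilon> \<or> frac x > 1 - \<epsilon>))"
    and "norm (of_real (1 / real (a + 1)) - integral {0..1} (\<lambda>x. P x ^ a)) \<le> 3 * K * \<epsilon>"
proof -
  have K: "real a * 2 ^ a \<le> K" "1 + 2 ^ a \<le> K" "K > 0" by (auto simp: K_def add_nonneg_pos)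
  have good: "norm (of_real (t ^ a) - P x ^ a) \<le> K * \<epsilon>"
    if "norm (P x - of_real t) \<le> \<epsilon>" "0 \<le> t" "t \<le> 1" for t x
  proof -
    have "norm (of_real t ^ a - P x ^ a) \<le> real a * 2 ^ a * norm (of_real t - P x)"
      using that by (intro norm_power_diff_le_bounded assms(2)) auto
    also have "\<dots> \<le> K * \<epsilon>"
      using that K by (intro mult_mono) (auto simp: norm_minus_commute)
    finally show ?thesis by simp
  qed
  have bad: "norm (of_real (t ^ a) - P x ^ a) \<le> K" if "0 \<le> t" "t \<le> 1" for t x
  proof -
    have "norm (of_real (t ^ a) - P x ^ a) \<le> norm (of_real (t ^ a) :: complex) + norm (P x ^ a)"
      by (rule norm_triangle_ineq4)
    also have "\<dots> \<le> 1 + 2 ^ a"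
      using that assms(2)[of x] by (intro add_mono) (auto simp: norm_power power_le_one intro: power_mono)
    finally show ?thesis using K by linarith
  qed
  show "norm (of_real (frac x ^ a) - P x ^ a) \<le> K * (\<epsilon> + of_bool (frac x < \<epsilon> \<or> frac x > 1 - \<epsilon>))"
  proof (cases "frac x < \<epsilon> \<or> frac x > 1 - \<epsilon>")
    case True
    have "norm (of_real (frac x ^ a) - P x ^ a) \<le> K * 1"
      using bad[of "frac x" x] frac_ge_0 frac_lt_1[of x] by (simp add: less_imp_le)
    also have "\<dots> \<le> K * (\<epsilon> + 1)" using K assms(3) by (intro mult_left_mono) auto
    finally show ?thesis using True by simp
  next
    case False
    then show ?thesis using good[OF close[of x]] frac_ge_0[of x] frac_lt_1[of x] by simp
  qed
  have P: "(\<lambda>x. P x ^ a) integrable_on {0..1}"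
    using assms(1) by (intro integrable_trig_poly trig_poly_power)
  have frac_int: "((\<lambda>x. of_real (x ^ a)) has_integral (of_real (1 / real (a + 1)) :: complex)) {0..1::real}"
  proof -
    have "((\<lambda>x. x ^ a) has_integral (1 ^ Suc a / Suc a - 0 ^ Suc a / Suc a)) {0..1::real}"
    proof (rule fundamental_theorem_of_calculus)
      fix x :: real
      have "((\<lambda>x. x ^ Suc a / Suc a) has_field_derivative x ^ a) (at x within {0..1})"
        by (rule derivative_eq_intros refl | simp)+
      then show "((\<lambda>x. x ^ Suc a / Suc a) has_vector_derivative x ^ a) (at x within {0..1})"
        by (simp add: has_real_derivative_iff_has_vector_derivative)
    qed simp
    then have "((\<lambda>x. x ^ a) has_integral 1 / real (a + 1)) {0..1::real}" by (simp add: add.commute)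
    then show ?thesis by (rule has_integral_of_real)
  qed
  let ?g = "\<lambda>x. K * (\<epsilon> + (if x \<in> {0..\<epsilon>} then 1 else 0) + (if x \<in> {1 - \<epsilon>..1} then 1 else 0))"
  have g: "(?g has_integral K * (\<epsilon> + \<epsilon> + \<epsilon>)) {0..1::real}"
  proof (intro has_integral_mult_right has_integral_add)
    show "((\<lambda>x. \<epsilon>) has_integral \<epsilon>) {0..1::real}" using has_integral_const_real[of \<epsilon> 0 1] by simp
    have step: "((\<lambda>x. if x \<in> {c..c + \<epsilon>} then 1 else 0) has_integral \<epsilon>) {0..1::real}"
      if "0 \<le> c" "c + \<epsilon> \<le> 1" for c
      using has_integral_const_real[of "1 :: real" c "c + \<epsilon>"] assms(3) that
        has_integral_restrict[of "{c..c + \<epsilon>}" "{0..1}" "\<lambda>_. 1 :: real" \<epsilon>] by auto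
    show "((\<lambda>x. if x \<in> {0..\<epsilon>} then 1 else 0) has_integral \<epsilon>) {0..1::real}"
      using step[of 0] assms(4) by simp
    show "((\<lambda>x. if x \<in> {1 - \<epsilon>..1} then 1 else 0) has_integral \<epsilon>) {0..1::real}"
      using step[of "1 - \<epsilon>"] assms(4) by simp
  qed
  have "of_real (1 / real (a + 1)) - integral {0..1} (\<lambda>x. P x ^ a) = integral {0..1} (\<lambda>x. of_real (x ^ a) - P x ^ a)"
    using frac_int P by (subst integral_diff) (auto simp: has_integral_iff)
  also have "norm \<dots> \<le> integral {0..1} ?g"
  proof (rule integral_norm_bound_integral)
    show "(\<lambda>x. of_real (x ^ a) - P x ^ a) integrable_on {0..1}"
      using frac_int P by (intro integrable_diff) auto
    show "?g integrable_on {0..1}" using g by blast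
    show "norm (of_real (x ^ a) - P x ^ a) \<le> ?g x" if "x \<in> {0..1}" for x
    proof (cases "x \<in> {0..\<epsilon>} \<or> x \<in> {1 - \<epsilon>..1}")
      case True
      have "norm (of_real (x ^ a) - P x ^ a) \<le> K * 1" using bad that by simp
      also have "\<dots> \<le> ?g x" using K assms(3) True by (intro mult_left_mono) auto
      finally show ?thesis .
    next
      case False
      then have "frac x = x" "\<epsilon> \<le> x" "x \<le> 1 - \<epsilon>" using that assms(3) by (auto simp: frac_eq)
      then have "norm (of_real (x ^ a) - P x ^ a) \<le> K * \<epsilon>" using good[of x x] close[of x] that by simp
      then show ?thesis using False by auto
    qed
  qed
  also have "\<dots> = K * (\<epsilon> + \<epsilon> + \<epsilon>)" using g by (rule integral_unique)
  finally show "norm (of_real (1 / real (a + 1)) - integral {0..1} (\<lambda>x. P x ^ a)) \<le> 3 * K * \<epsilon>" by simp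
qed

lemma tendsto_if_approximable:
  fixes A :: "nat \<Rightarrow> complex"
  assumes "\<And>\<eta>. \<eta> > 0 \<Longrightarrow> \<exists>B c'. B \<longlonglongrightarrow> c' \<and> norm (c' - c) \<le> \<eta> \<and> (\<forall>\<^sub>F n in sequentially. norm (A n - B n) \<le> \<eta>)"
  shows "A \<longlonglongrightarrow> c"
proof (rule tendstoI)
  fix r :: real assume "r > 0"
  then obtain B c' where B: "B \<longlonglongrightarrow> c'" "norm (c' - c) \<le> r / 4" "\<forall>\<^sub>F n in sequentially. norm (A n - B n) \<le> r / 4"
    using assms[of "r / 4"] by auto
  have "\<forall>\<^sub>F n in sequentially. dist (B n) c' < r / 4" using B(1) \<open>r > 0\<close> by (intro tendstoD) auto
  with B(3) show "\<forall>\<^sub>F n in sequentially. dist (A n) c < r"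
  proof eventually_elim
    case (elim n)
    have "norm (A n - c) \<le> norm (A n - B n) + norm (B n - c') + norm (c' - c)" by norm
    then show ?case using elim B(2) \<open>r > 0\<close> unfolding dist_norm by linarith
  qed
qed

text \<open>
  Replacing \<open>frac\<close> by a trigonometric polynomial changes the averages over many
  terms only a little, because points near the integers are rare
  (\<open>near_integer_frequency\<close>). It changes the product of the integrals just as little, and for
  trigonometric polynomials averages and integrals agree.
\<close>
lemma has_mean_frac_powers:
  fixes \<alpha> \<beta> :: real
  assumes irr: "\<alpha> \<notin> \<rat>" "\<beta> \<notin> \<rat>"
    and indep: "\<And>k l. of_int k * \<alpha> + of_int l * \<beta> \<in> \<int> \<Longrightarrow> k = 0 \<and> l = 0"
  shows "has_mean (\<lambda>j. frac (real j * \<alpha>) ^ a * frac (real j * \<beta>) ^ b) (1 / (real (a + 1) * real (b + 1)))"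
proof -
  define f where "f x a = complex_of_real (frac x ^ a)" for x a
  define K where "K a = real a * 2 ^ a + 2 ^ a + 1" for a
  define L where "L = K a + 2 ^ a * K b"
  have Kpos: "K a \<ge> 0" for a unfolding K_def by simp
  then have Lpos: "L \<ge> 0" "K a \<le> L" "2 ^ a * K b \<le> L" unfolding L_def by auto
  have "(\<lambda>N. (\<Sum>j=1..N. f (real j * \<alpha>) a * f (real j * \<beta>) b) / of_nat N) \<longlonglongrightarrow> of_real (1 / real (a + 1) * (1 / real (b + 1)))"
  proof (rule tendsto_if_approximable)
    fix \<eta> :: real assume "\<eta> > 0"
    \<comment> \<open>\<open>2 * \<epsilon> \<le> 2 * \<delta>\<close> bounds the errors at good points, and each of the two exceptional sets contributes \<open>\<delta>\<close>\<close>
    define \<delta> where "\<delta> = \<eta> / (4 * L + 1)"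
    have "\<delta> > 0" using \<open>\<eta> > 0\<close> Lpos by (simp add: \<delta>_def)
    have \<delta>: "4 * L * \<delta> \<le> \<eta>" using \<open>\<eta> > 0\<close> Lpos by (simp add: \<delta>_def field_simps)
    define bad where "bad \<epsilon> x \<longleftrightarrow> frac x < \<epsilon> \<or> frac x > 1 - \<epsilon>" for \<epsilon> x :: real
    obtain \<epsilon>1 where \<epsilon>1: "\<epsilon>1 > 0" "\<And>\<epsilon>. \<epsilon> \<le> \<epsilon>1 \<Longrightarrow> \<forall>\<^sub>F N in sequentially. card {j \<in> {1..N}. bad \<epsilon> (real j * \<alpha>)} / N \<le> \<delta>"
      using near_integer_frequency[OF irr(1) \<open>\<delta> > 0\<close>] unfolding bad_def by blast
    obtain \<epsilon>2 where \<epsilon>2: "\<epsilon>2 > 0" "\<And>\<epsilon>. \<epsilon> \<le> \<epsilon>2 \<Longrightarrow> \<forall>\<^sub>F N in sequentially. card {j \<in> {1..N}. bad \<epsilon> (real j * \<beta>)} / N \<le> \<delta>"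
      using near_integer_frequency[OF irr(2) \<open>\<delta> > 0\<close>] unfolding bad_def by blast
    define \<epsilon> where "\<epsilon> = Min {\<epsilon>1, \<epsilon>2, \<delta>, 1 / 2}"
    have \<epsilon>: "0 < \<epsilon>" "\<epsilon> \<le> \<epsilon>1" "\<epsilon> \<le> \<epsilon>2" "\<epsilon> \<le> \<delta>" "\<epsilon> \<le> 1 / 2"
      using \<epsilon>1(1) \<epsilon>2(1) \<open>\<delta> > 0\<close> by (auto simp: \<epsilon>_def)
    obtain P where P: "trig_poly P" "\<And>x. norm (P x) \<le> 2"
      "\<And>x. \<epsilon> \<le> frac x \<Longrightarrow> frac x \<le> 1 - \<epsilon> \<Longrightarrow> norm (P x - of_real (frac x)) \<le> \<epsilon>"
      using trig_poly_approximates_frac[OF \<epsilon>(1)] by blast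
    let ?I = "\<lambda>a. integral {0..1} (\<lambda>x. P x ^ a)"
    have pt: "norm (f x a - P x ^ a) \<le> K a * (\<epsilon> + of_bool (bad \<epsilon> x))" for x a
      unfolding f_def K_def bad_def
      by (rule trig_poly_approximates_frac_power(1)) (use P \<epsilon> in auto)
    have int: "norm (of_real (1 / real (a + 1)) - ?I a) \<le> 3 * K a * \<epsilon>" for a
      unfolding K_def by (rule trig_poly_approximates_frac_power(2)) (use P \<epsilon> in auto)
    have Pa: "norm (P x ^ a) \<le> 2 ^ a" for x a using P(2) by (simp add: norm_power power_mono)
    have fa: "norm (f x a) \<le> 1" for x a
      using frac_ge_0[of x] frac_lt_1[of x] by (simp add: f_def norm_power power_le_one)
    have prod: "norm (u * v - u' * v') \<le> norm (u - u') * norm v + norm u' * norm (v - v')" for u v u' v' :: complex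
    proof -
      have "u * v - u' * v' = (u - u') * v + u' * (v - v')" by (simp add: algebra_simps)
      then show ?thesis by (metis norm_mult norm_triangle_ineq)
    qed
    let ?B = "\<lambda>N::nat. (\<Sum>j=1..N. P (real j * \<alpha>) ^ a * P (real j * \<beta>) ^ b) / of_nat N"
    have "?B \<longlonglongrightarrow> ?I a * ?I b"
      using has_mean_trig_poly_product[where \<alpha> = \<alpha> and \<beta> = \<beta>, OF indep trig_poly_power[OF P(1), of a] trig_poly_power[OF P(1), of b]]
      by (simp add: has_mean_def)
    moreover have "norm (?I a * ?I b - of_real (1 / real (a + 1) * (1 / real (b + 1)))) \<le> \<eta>"
    proof -
      have "norm (?I a) \<le> 2 ^ a"
        using integral_bound[of 0 1 "\<lambda>x. P x ^ a" "2 ^ a"] Pa P(1)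
        by (auto intro: continuous_on_trig_poly trig_poly_power)
      moreover have "norm (of_real (1 / real (b + 1)) :: complex) \<le> 1" unfolding norm_of_real by simp
      ultimately have "norm (of_real (1 / real (a + 1)) * of_real (1 / real (b + 1)) - ?I a * ?I b) \<le> 3 * K a * \<epsilon> * 1 + 2 ^ a * (3 * K b * \<epsilon>)"
        using Kpos \<epsilon>(1) by (intro order.trans[OF prod] add_mono mult_mono int) auto
      also have "\<dots> = 3 * L * \<epsilon>" by (simp add: L_def algebra_simps)
      also have "\<dots> \<le> 4 * L * \<delta>" using Lpos \<epsilon> by (intro mult_mono) auto
      finally show ?thesis using \<delta> by (simp add: norm_minus_commute)
    qed
    moreover have "\<forall>\<^sub>F N in sequentially. norm ((\<Sum>j=1..N. f (real j * \<alpha>) a * f (real j * \<beta>) b) / of_nat N - ?B N) \<le> \<eta>"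
      using \<epsilon>1(2)[OF \<epsilon>(2)] \<epsilon>2(2)[OF \<epsilon>(3)] eventually_gt_at_top[of 0]
    proof eventually_elim
      case (elim N)
      let ?w = "\<lambda>x. \<epsilon> + of_bool (bad \<epsilon> x)"
      have avg: "(\<Sum>j=1..N. ?w (real j * \<gamma>)) = N * \<epsilon> + card {j \<in> {1..N}. bad \<epsilon> (real j * \<gamma>)}" for \<gamma>
        by (simp add: sum.distrib of_bool_def sum.If_cases Int_def)
      have "norm ((\<Sum>j=1..N. f (real j * \<alpha>) a * f (real j * \<beta>) b) / of_nat N - ?B N) =
          norm (\<Sum>j=1..N. f (real j * \<alpha>) a * f (real j * \<beta>) b - P (real j * \<alpha>) ^ a * P (real j * \<beta>) ^ b) / N"
        by (simp add: sum_subtractf diff_divide_distrib[symmetric] norm_divide)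
      also have "\<dots> \<le> (\<Sum>j=1..N. L * (?w (real j * \<alpha>) + ?w (real j * \<beta>))) / N"
      proof (intro divide_right_mono order.trans[OF norm_sum] sum_mono)
        fix j
        have "norm (f (real j * \<alpha>) a * f (real j * \<beta>) b - P (real j * \<alpha>) ^ a * P (real j * \<beta>) ^ b) \<le>
            K a * ?w (real j * \<alpha>) * 1 + 2 ^ a * (K b * ?w (real j * \<beta>))"
          using Kpos \<epsilon>(1) by (intro order.trans[OF prod] add_mono mult_mono pt Pa fa) auto
        also have "\<dots> = K a * ?w (real j * \<alpha>) + (2 ^ a * K b) * ?w (real j * \<beta>)" by simp
        also have "\<dots> \<le> L * ?w (real j * \<alpha>) + L * ?w (real j * \<beta>)"
          using Lpos \<epsilon>(1) by (intro add_mono mult_right_mono) auto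
        finally show "norm (f (real j * \<alpha>) a * f (real j * \<beta>) b - P (real j * \<alpha>) ^ a * P (real j * \<beta>) ^ b) \<le>
            L * (?w (real j * \<alpha>) + ?w (real j * \<beta>))" by (simp only: distrib_left)
      qed simp
      also have "\<dots> = L * (2 * \<epsilon> + card {j \<in> {1..N}. bad \<epsilon> (real j * \<alpha>)} / N + card {j \<in> {1..N}. bad \<epsilon> (real j * \<beta>)} / N)"
        unfolding sum_distrib_left[symmetric] sum.distrib[of "\<lambda>j. ?w (real j * \<alpha>)"] avg
        using elim by (simp add: field_simps)
      also have "\<dots> \<le> L * (2 * \<delta> + \<delta> + \<delta>)"
        using elim \<epsilon> Lpos by (intro mult_left_mono add_mono) auto
      also have "\<dots> \<le> \<eta>" using \<delta> by (simp add: algebra_simps)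
      finally show ?case .
    qed
    ultimately show "\<exists>B c'. B \<longlonglongrightarrow> c' \<and> norm (c' - of_real (1 / real (a + 1) * (1 / real (b + 1)))) \<le> \<eta> \<and>
        (\<forall>\<^sub>F N in sequentially. norm ((\<Sum>j=1..N. f (real j * \<alpha>) a * f (real j * \<beta>) b) / of_nat N - B N) \<le> \<eta>)"
      by blast
  qed
  from tendsto_Re[OF this]
  have "(\<lambda>N. Re ((\<Sum>j=1..N. f (real j * \<alpha>) a * f (real j * \<beta>) b) / of_nat N))
      \<longlonglongrightarrow> 1 / real (a + 1) * (1 / real (b + 1))" by (simp only: Re_complex_of_real)
  moreover have "(\<Sum>j=1..N. f (real j * \<alpha>) a * f (real j * \<beta>) b) / of_nat N =
      of_real ((\<Sum>j=1..N. frac (real j * \<alpha>) ^ a * frac (real j * \<beta>) ^ b) / of_nat N)" for N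
    by (simp add: f_def)
  ultimately show ?thesis by (simp only: Re_complex_of_real has_mean_def) simp
qed

text \<open>
  After absorbing the denominators this is the alternating sum of the row \<open>i + 2\<close> of
  Pascal's triangle without its two outer terms.
\<close>
lemma alternating_binomial_reciprocals:
  "(\<Sum>a\<le>i. real (i choose a) * (- 1) ^ (i - a) / (real (a + 1) * real (i - a + 1))) = (1 + (- 1) ^ i) / (real (i + 1) * real (i + 2))"
proof -
  have "real (i choose a) * (- 1) ^ (i - a) / (real (a + 1) * real (i - a + 1)) =
      (- ((- 1) ^ i)) * ((- 1) ^ (a + 1) * real (i + 2 choose (a + 1))) / (real (i + 1) * real (i + 2))" if "a \<le> i" for a
  proof -
    have 1: "real (Suc a) * real (Suc (Suc i) choose Suc a) = real (Suc (Suc i)) * real (Suc i choose a)"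
      using arg_cong[OF Suc_times_binomial[of a "Suc i"], of real] by (simp only: of_nat_mult)
    have 2: "real (i - a + 1) * real (Suc i choose a) = real (Suc i) * real (i choose a)"
      using arg_cong[OF binomial_absorb_comp[of "Suc i" a], of real] that
      by (simp only: of_nat_mult Suc_diff_le diff_Suc_1 Suc_eq_plus1[symmetric])
    have quot: "real (i choose a) / (real (a + 1) * real (i - a + 1)) = real (i + 2 choose (a + 1)) / (real (i + 1) * real (i + 2))"
    proof -
      have "real (i choose a) * (real (i + 1) * real (i + 2)) = real (i + 2 choose (a + 1)) * (real (a + 1) * real (i - a + 1))"
      proof -
        have "real (i choose a) * (real (i + 1) * real (i + 2)) = real (i + 2) * (real (Suc i) * real (i choose a))"
          by simp
        also have "\<dots> = real (i - a + 1) * (real (Suc (Suc i)) * real (Suc i choose a))"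
          unfolding 2[symmetric] by simp
        also have "\<dots> = real (i + 2 choose (a + 1)) * (real (a + 1) * real (i - a + 1))"
          unfolding 1[symmetric] by simp
        finally show ?thesis .
      qed
      then show ?thesis by (simp add: frac_eq_eq del: of_nat_mult)
    qed
    have sign: "(- 1 :: real) ^ (i - a) = (- ((- 1) ^ i)) * (- 1) ^ (a + 1)"
      using that by (simp add: minus_one_power_iff)
    have "real (i choose a) * (- 1) ^ (i - a) / (real (a + 1) * real (i - a + 1)) =
        (- 1) ^ (i - a) * (real (i choose a) / (real (a + 1) * real (i - a + 1)))" by simp
    then show ?thesis unfolding quot sign by simp
  qed
  then have "(\<Sum>a\<le>i. real (i choose a) * (- 1) ^ (i - a) / (real (a + 1) * real (i - a + 1))) =
      (\<Sum>a\<le>i. (- ((- 1) ^ i)) * ((- 1) ^ (a + 1) * real (i + 2 choose (a + 1))) / (real (i + 1) * real (i + 2)))"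
    by (intro sum.cong) (simp_all only: atMost_iff)
  also have "\<dots> = (- ((- 1) ^ i)) * (\<Sum>a\<le>i. (- 1) ^ (a + 1) * real (i + 2 choose (a + 1))) / (real (i + 1) * real (i + 2))"
    by (simp only: sum_distrib_left sum_divide_distrib)
  also have "(\<Sum>a\<le>i. (- 1) ^ (a + 1) * real (i + 2 choose (a + 1))) = - 1 - (- 1) ^ i"
  proof -
    define g where "g a = (- 1) ^ a * real (i + 2 choose a)" for a
    have "0 = (\<Sum>a\<le>Suc (Suc i). g a)"
      using choose_alternating_sum[of "Suc (Suc i)", where 'a = real] by (simp only: g_def) simp
    also have "\<dots> = (\<Sum>a\<le>Suc i. g a) + g (i + 2)" using sum.atMost_Suc[of g "Suc i"] by simp
    also have "(\<Sum>a\<le>Suc i. g a) = g 0 + (\<Sum>a\<le>i. g (a + 1))"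
      using sum.atMost_Suc_shift[of g i] by (simp only: Suc_eq_plus1)
    also have "g 0 = 1" by (simp add: g_def)
    also have "g (i + 2) = (- 1) ^ i" by (simp add: g_def)
    also have "(\<Sum>a\<le>i. g (a + 1)) = (\<Sum>a\<le>i. (- 1) ^ (a + 1) * real (i + 2 choose (a + 1)))"
      by (simp only: g_def)
    finally show ?thesis by linarith
  qed
  also have "(- ((- 1) ^ i)) * (- 1 - (- 1) ^ i) = (1 + (- 1) ^ i :: real)"
    by (cases "even i") auto
  finally show ?thesis .
qed

lemma has_mean_frac_difference_power:
  fixes \<alpha> \<beta> :: real
  assumes "\<alpha> \<notin> \<rat>" "\<beta> \<notin> \<rat>"
    and "\<And>k l. of_int k * \<alpha> + of_int l * \<beta> \<in> \<int> \<Longrightarrow> k = 0 \<and> l = 0"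
  shows "has_mean (\<lambda>j. (frac (real j * \<alpha>) - frac (real j * \<beta>)) ^ i) ((1 + (- 1) ^ i) / (real (i + 1) * real (i + 2)))"
proof -
  have "has_mean (\<lambda>j. \<Sum>a\<le>i. real (i choose a) * (- 1) ^ (i - a) * (frac (real j * \<alpha>) ^ a * frac (real j * \<beta>) ^ (i - a)))
      (\<Sum>a\<le>i. real (i choose a) * (- 1) ^ (i - a) * (1 / (real (a + 1) * real (i - a + 1))))"
    by (intro has_mean_sum has_mean_cmult has_mean_frac_powers assms) auto
  moreover have "(\<Sum>a\<le>i. real (i choose a) * (- 1) ^ (i - a) * (frac (real j * \<alpha>) ^ a * frac (real j * \<beta>) ^ (i - a))) =
      (frac (real j * \<alpha>) - frac (real j * \<beta>)) ^ i" for j :: nat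
  proof -
    have "(frac (real j * \<alpha>) - frac (real j * \<beta>)) ^ i = (frac (real j * \<alpha>) + (- 1) * frac (real j * \<beta>)) ^ i" by simp
    then show ?thesis unfolding binomial_ring power_mult_distrib by (simp add: mult_ac)
  qed
  ultimately show ?thesis
    unfolding alternating_binomial_reciprocals[symmetric] by simp
qed

lemma rat_independent_int_combination:
  fixes \<alpha> \<beta> :: real
  assumes "rat_independent {1, \<alpha>, \<beta>}" "\<alpha> \<noteq> 1" "\<beta> \<noteq> 1" "\<alpha> \<noteq> \<beta>"
    and "of_int k * \<alpha> + of_int l * \<beta> \<in> \<int>"
  shows "k = 0 \<and> l = 0"
proof -
  interpret module "\<lambda>(q :: rat) (x :: real). of_rat q * x"
    by unfold_locales (simp_all add: distrib_left distrib_right of_rat_add of_rat_mult)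
  obtain m where m: "of_int k * \<alpha> + of_int l * \<beta> = of_int m" using assms(5) by (rule Ints_cases)
  define c :: "real \<Rightarrow> rat" where "c x = (if x = 1 then - of_int m else if x = \<alpha> then of_int k else of_int l)" for x
  have c: "c 1 = - of_int m" "c \<alpha> = of_int k" "c \<beta> = of_int l" using assms(2-4) by (simp_all add: c_def)
  have "(\<Sum>x\<in>{1, \<alpha>, \<beta>}. of_rat (c x) * x) = 0"
  proof -
    have "(\<Sum>x\<in>{1, \<alpha>, \<beta>}. of_rat (c x) * x) = - of_int m + (of_int k * \<alpha> + of_int l * \<beta>)"
      using assms(2-4) by (simp add: c of_rat_minus)
    then show ?thesis unfolding m by simp
  qed
  then have "c x = 0" if "x \<in> {1, \<alpha>, \<beta>}" for x
    using independentD[OF assms(1), of "{1, \<alpha>, \<beta>}" c x] that by blast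
  from this[of \<alpha>] this[of \<beta>] show ?thesis by (simp add: c)
qed

section \<open>The Stieltjes transform of the limit law\<close>

text \<open>
  The moments of the triangular density \<open>1 - \<bar>x\<bar>\<close> on \<open>[-1, 1]\<close>.
\<close>
definition triangular_moment :: "nat \<Rightarrow> real" where
  "triangular_moment i = (1 + (- 1) ^ i) / (real (i + 1) * real (i + 2))"

text \<open>
  The logarithm with its branch cut rotated to the negative imaginary axis, which makes it
  continuous on the closed upper half plane without 0 and holomorphic in its interior. On the
  negative reals its imaginary part is \<open>pi\<close>. Its default value at 0 only occurs multiplied by 0.
\<close>
definition upper_Ln :: "complex \<Rightarrow> complex" where
  "upper_Ln w = Ln (- \<i> * w) + \<i> * of_real (pi / 2)"

lemma neg_ii_times_nonpos_Reals:
  assumes "Im w \<ge> 0" "w \<noteq> 0"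
  shows "- \<i> * w \<notin> \<real>\<^sub>\<le>\<^sub>0"
  using assms by (auto simp: complex_nonpos_Reals_iff complex_eq_iff)

lemma exp_upper_Ln: "w \<noteq> 0 \<Longrightarrow> exp (upper_Ln w) = w"
proof -
  assume "w \<noteq> 0"
  have "exp (\<i> * of_real (pi / 2)) = \<i>" by (simp only: cis_conv_exp[symmetric] cis_pi_half)
  moreover have "(- \<i> * w) * \<i> = w" by (simp add: complex_eq_iff)
  ultimately show ?thesis using \<open>w \<noteq> 0\<close> by (simp only: upper_Ln_def exp_add exp_Ln) simp
qed

lemma continuous_on_upper_Ln: "continuous_on ({w. Im w \<ge> 0} - {0}) upper_Ln"
  unfolding upper_Ln_def using neg_ii_times_nonpos_Reals
  by (intro continuous_intros) auto

lemma upper_Ln_field_differentiable: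
  assumes "Im w > 0"
  shows "upper_Ln field_differentiable at w"
proof -
  have "- \<i> * w \<notin> \<real>\<^sub>\<le>\<^sub>0" using assms by (intro neg_ii_times_nonpos_Reals) auto
  then have "(Ln has_field_derivative inverse (- \<i> * w)) (at (- \<i> * w))"
    by (rule has_field_derivative_Ln)
  moreover have "((\<lambda>w. - \<i> * w) has_field_derivative - \<i>) (at w)"
    by (rule DERIV_cmult_Id)
  ultimately have "((\<lambda>w. Ln (- \<i> * w) + \<i> * of_real (pi / 2)) has_field_derivative
      inverse (- \<i> * w) * - \<i> + 0) (at w)"
    by (intro DERIV_add DERIV_const DERIV_chain2)
  then have "(upper_Ln has_field_derivative inverse (- \<i> * w) * - \<i> + 0) (at w)"
    by (simp only: upper_Ln_def[abs_def])
  then show ?thesis by (auto simp: field_differentiable_def)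
qed

lemma norm_upper_Ln_le:
  assumes "w \<noteq> 0"
  shows "norm (upper_Ln w) \<le> \<bar>ln (norm w)\<bar> + 3 / 2 * pi"
proof -
  have "norm (Ln (- \<i> * w)) \<le> \<bar>Re (Ln (- \<i> * w))\<bar> + \<bar>Im (Ln (- \<i> * w))\<bar>" by (rule cmod_le)
  also have "\<bar>Re (Ln (- \<i> * w))\<bar> = \<bar>ln (norm w)\<bar>" using assms by (simp add: norm_mult)
  also have "\<bar>Im (Ln (- \<i> * w))\<bar> \<le> pi"
    using Im_Ln_le_pi[of "- \<i> * w"] mpi_less_Im_Ln[of "- \<i> * w"] assms by simp
  finally have "norm (Ln (- \<i> * w)) \<le> \<bar>ln (norm w)\<bar> + pi" by simp
  moreover have "norm (\<i> * of_real (pi / 2)) = pi / 2" by (simp add: norm_mult)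
  ultimately show ?thesis
    unfolding upper_Ln_def using norm_triangle_ineq[of "Ln (- \<i> * w)" "\<i> * of_real (pi / 2)"] by linarith
qed

text \<open>
  At 0 the factor \<open>w\<^sup>2\<close> beats the logarithmic singularity, by \<open>\<bar>ln x\<bar> \<le> 1 / x\<close> for \<open>0 < x \<le> 1\<close>.
\<close>
lemma continuous_on_sq_upper_Ln: "continuous_on {w. Im w \<ge> 0} (\<lambda>w. w ^ 2 * upper_Ln w)"
proof -
  let ?H = "{w. Im w \<ge> 0}"
  have away: "continuous_on (?H - {0}) (\<lambda>w. w ^ 2 * upper_Ln w)"
    by (intro continuous_intros continuous_on_upper_Ln)
  have zero: "((\<lambda>w. w ^ 2 * upper_Ln w) \<longlongrightarrow> 0) (at 0)"
  proof (rule Lim_null_comparison)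
    show "\<forall>\<^sub>F w in at 0. norm (w ^ 2 * upper_Ln w) \<le> norm w + 3 / 2 * pi * norm w ^ 2"
      unfolding eventually_at
    proof (intro exI[of _ 1] conjI ballI impI)
      fix w :: complex assume w: "w \<noteq> 0 \<and> dist w 0 < 1"
      then have pos: "norm w > 0" "norm w < 1" by (auto simp: dist_norm)
      have "\<bar>ln (norm w)\<bar> = ln (1 / norm w)" using pos by (simp add: ln_div)
      also have "\<dots> \<le> 1 / norm w - 1" using pos by (intro ln_le_minus_one) auto
      finally have "norm (upper_Ln w) \<le> 1 / norm w + 3 / 2 * pi" using norm_upper_Ln_le[of w] w by linarith
      then have "norm w ^ 2 * norm (upper_Ln w) \<le> norm w ^ 2 * (1 / norm w + 3 / 2 * pi)"
        by (intro mult_left_mono) auto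
      also have "\<dots> = norm w + 3 / 2 * pi * norm w ^ 2" using pos by (simp add: field_simps power2_eq_square)
      finally show "norm (w ^ 2 * upper_Ln w) \<le> norm w + 3 / 2 * pi * norm w ^ 2"
        by (simp only: norm_mult norm_power)
    qed simp
    have "((\<lambda>w :: complex. norm w + 3 / 2 * pi * norm w ^ 2) \<longlongrightarrow> norm (0 :: complex) + 3 / 2 * pi * norm (0 :: complex) ^ 2) (at 0)"
      by (intro tendsto_intros)
    then show "((\<lambda>w :: complex. norm w + 3 / 2 * pi * norm w ^ 2) \<longlongrightarrow> 0) (at 0)" by simp
  qed
  show ?thesis
    unfolding continuous_on_def
  proof
    fix x assume x: "x \<in> ?H"
    show "((\<lambda>w. w ^ 2 * upper_Ln w) \<longlongrightarrow> x ^ 2 * upper_Ln x) (at x within ?H)"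
    proof (cases "x = 0")
      case True
      then show ?thesis using tendsto_within_subset[OF zero, of ?H] by simp
    next
      case False
      then have "((\<lambda>w. w ^ 2 * upper_Ln w) \<longlongrightarrow> x ^ 2 * upper_Ln x) (at x within ?H - {0})"
        using away x by (auto simp: continuous_on_def)
      moreover have "at x within ?H - {0} = at x within ?H"
        using False by (intro at_within_nhd[of _ "- {0}"]) auto
      ultimately show ?thesis by simp
    qed
  qed
qed

text \<open>
  The Stieltjes transform of the limit law. The exponent is minus the integral of
  \<open>log (w - x) * (1 - \<bar>x\<bar>)\<close> over \<open>[-1, 1]\<close>, evaluated with the second antiderivative
  \<open>w\<^sup>2 * log w / 2 - 3 / 4 * w\<^sup>2\<close> of the logarithm. The constant \<open>3 / 2\<close> comes from the second difference of
  its quadratic part.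
\<close>
definition stieltjes :: "complex \<Rightarrow> complex" where
  "stieltjes w = exp (3 / 2 - (w + 1) ^ 2 * upper_Ln (w + 1) / 2
     - (w - 1) ^ 2 * upper_Ln (w - 1) / 2 + w ^ 2 * upper_Ln w)"

lemma continuous_on_stieltjes: "continuous_on {w. Im w \<ge> 0} stieltjes"
proof -
  have shift: "continuous_on {w. Im w \<ge> 0} (\<lambda>w. (w + of_real c) ^ 2 * upper_Ln (w + of_real c))" for c
    by (rule continuous_on_compose2[OF continuous_on_sq_upper_Ln]) (auto intro!: continuous_intros)
  show ?thesis
    unfolding stieltjes_def using shift[of 1] shift[of "-1"]
    by (intro continuous_on_exp continuous_on_add continuous_on_diff continuous_on_divide
          continuous_on_const continuous_on_sq_upper_Ln) auto
qed

lemma stieltjes_field_differentiable: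
  assumes "Im w > 0"
  shows "stieltjes field_differentiable at w"
proof -
  obtain D where D: "(upper_Ln has_field_derivative D) (at w)"
    using upper_Ln_field_differentiable[OF assms] by (auto simp: field_differentiable_def)
  have "\<exists>D. ((\<lambda>w. upper_Ln (w + of_real c)) has_field_derivative D) (at w)" for c
    using upper_Ln_field_differentiable[of "w + of_real c"] assms
    by (auto simp: field_differentiable_def DERIV_shift)
  from this[of 1] this[of "-1"] obtain D1 D2 where
    D1: "((\<lambda>w. upper_Ln (w + 1)) has_field_derivative D1) (at w)" and
    D2: "((\<lambda>w. upper_Ln (w - 1)) has_field_derivative D2) (at w)"
    by auto
  show ?thesis
    unfolding stieltjes_def field_differentiable_def
    by (rule exI) (rule derivative_eq_intros D D1 D2 refl | simp)+
qed

lemma upper_Ln_of_real: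
  assumes "t \<noteq> 0"
  shows "upper_Ln (of_real t) = of_real (ln \<bar>t\<bar>) + \<i> * of_real (if t < 0 then pi else 0)"
proof -
  have "Ln (- \<i> * of_real t) = of_real (ln \<bar>t\<bar>) + \<i> * of_real (if t < 0 then pi / 2 else - pi / 2)"
  proof (rule Ln_unique)
    have "exp (of_real (ln \<bar>t\<bar>) + \<i> * of_real (if t < 0 then pi / 2 else - pi / 2)) =
        of_real \<bar>t\<bar> * cis (if t < 0 then pi / 2 else - pi / 2)"
      using assms by (simp add: exp_add exp_of_real cis_conv_exp)
    also have "\<dots> = - \<i> * of_real t" by (auto simp: complex_eq_iff)
    finally show "exp (of_real (ln \<bar>t\<bar>) + \<i> * of_real (if t < 0 then pi / 2 else - pi / 2)) = - \<i> * of_real t" .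
    have "- pi < - pi / 2" "- pi / 2 \<le> pi" using pi_gt_zero by linarith+
    then show "- pi < Im (of_real (ln \<bar>t\<bar>) + \<i> * of_real (if t < 0 then pi / 2 else - pi / 2))"
      "Im (of_real (ln \<bar>t\<bar>) + \<i> * of_real (if t < 0 then pi / 2 else - pi / 2)) \<le> pi" by auto
  qed
  then show ?thesis by (simp add: upper_Ln_def complex_eq_iff)
qed

text \<open>
  The imaginary part of the exponent consists of the contributions \<open>pi\<close> of the three logarithms at
  those arguments that are negative.
\<close>
lemma Im_stieltjes_of_real:
  "Im (stieltjes (of_real t)) =
     exp (3 / 2 - (t + 1) ^ 2 * ln \<bar>t + 1\<bar> / 2 - (t - 1) ^ 2 * ln \<bar>t - 1\<bar> / 2 + t ^ 2 * ln \<bar>t\<bar>) *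
     sin (- pi / 2 * (of_bool (t < - 1) * (t + 1) ^ 2 + of_bool (t < 1) * (t - 1) ^ 2) + pi * of_bool (t < 0) * t ^ 2)"
proof -
  have sq: "(of_real x) ^ 2 * upper_Ln (of_real x) =
      of_real (x ^ 2 * ln \<bar>x\<bar>) + \<i> * of_real (pi * of_bool (x < 0) * x ^ 2)" for x
    by (cases "x = 0") (auto simp: upper_Ln_of_real algebra_simps)
  have one: "of_real t + 1 = (of_real (t + 1) :: complex)" "of_real t - 1 = (of_real (t - 1) :: complex)" by simp_all
  have lt: "t + 1 < 0 \<longleftrightarrow> t < - 1" "t - 1 < 0 \<longleftrightarrow> t < 1" by auto
  show ?thesis
    unfolding stieltjes_def one sq Im_exp by (simp add: lt) (simp add: algebra_simps add_divide_distrib)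
qed

text \<open>
  The argument of \<open>1 + z\<close> is less than \<open>pi / 2\<close> in absolute value, so the arguments add up without
  crossing the cut.
\<close>
lemma upper_Ln_mult:
  assumes "Im w \<ge> 0" "w \<noteq> 0" "norm z < 1"
  shows "upper_Ln (w * (1 + z)) = upper_Ln w + Ln (1 + z)"
proof -
  have "Re (1 + z) > 0" using abs_Re_le_cmod[of z] assms(3) by simp
  then have z: "1 + z \<noteq> 0" "\<bar>Im (Ln (1 + z))\<bar> < pi / 2"
    using Re_Ln_pos_lt_imp[of "1 + z"] by (metis order_less_irrefl zero_complex.sel(1))+
  have w: "\<bar>Im (Ln (- \<i> * w))\<bar> \<le> pi / 2" using assms Re_Ln_pos_le[of "- \<i> * w"] by simp
  have "Ln ((- \<i> * w) * (1 + z)) = Ln (- \<i> * w) + Ln (1 + z)"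
    using z w assms(2) by (intro Ln_times_simple) (simp, simp, linarith+)
  then show ?thesis by (simp add: upper_Ln_def mult_ac)
qed

text \<open>
  The logarithm of \<open>w * stieltjes w\<close> as a function of \<open>z = 1 / w\<close>. The terms with \<open>log w\<close> cancel, and
  the singularity at \<open>z = 0\<close> is removable with value 0.
\<close>
definition log_transform :: "complex \<Rightarrow> complex" where
  "log_transform z = (if z = 0 then 0 else
     3 / 2 - ((1 + z) ^ 2 * Ln (1 + z) + (1 - z) ^ 2 * Ln (1 - z)) / (2 * z ^ 2))"

lemma stieltjes_at_infinity:
  assumes "Im w \<ge> 0" "norm w > 1"
  shows "w * stieltjes w = exp (log_transform (1 / w))"
proof -
  have w: "w \<noteq> 0" using assms by auto
  define z where "z = 1 / w"
  have z: "norm z < 1" "z \<noteq> 0" using assms w by (auto simp: z_def norm_divide)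
  have "w + 1 = w * (1 + z)" "w - 1 = w * (1 + - z)" using w by (auto simp: z_def field_simps)
  then have L: "upper_Ln (w + 1) = upper_Ln w + Ln (1 + z)" "upper_Ln (w - 1) = upper_Ln w + Ln (1 - z)"
    using upper_Ln_mult[OF assms(1) w, of z] upper_Ln_mult[OF assms(1) w, of "- z"] z by auto
  have "3 / 2 - (w + 1) ^ 2 * upper_Ln (w + 1) / 2 - (w - 1) ^ 2 * upper_Ln (w - 1) / 2 + w ^ 2 * upper_Ln w
      = log_transform z - upper_Ln w"
  proof -
    have "(w + 1) ^ 2 = (1 + z) ^ 2 / z ^ 2" "(w - 1) ^ 2 = (1 - z) ^ 2 / z ^ 2"
      using w by (simp_all add: z_def field_simps power2_eq_square)
    then have "log_transform z = 3 / 2 - (w + 1) ^ 2 * Ln (1 + z) / 2 - (w - 1) ^ 2 * Ln (1 - z) / 2"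
      using z(2) by (simp add: log_transform_def add_divide_distrib mult.commute)
    then show ?thesis unfolding L by (simp add: power2_eq_square algebra_simps add_divide_distrib diff_divide_distrib)
  qed
  then have "stieltjes w = exp (log_transform z) / w"
    by (simp add: stieltjes_def exp_diff exp_upper_Ln w)
  then show ?thesis using w by (simp add: z_def)
qed

text \<open>
  The constant coefficient is 0 because of the division by \<open>real 0\<close>.
\<close>
definition log_transform_fps :: "complex fps" where
  "log_transform_fps = Abs_fps (\<lambda>i. of_real (triangular_moment i / real i))"

lemma has_fps_expansion_Ln_1_plus: "(\<lambda>z. Ln (1 + z)) has_fps_expansion Abs_fps (\<lambda>n. - ((- 1) ^ n) / of_nat n)"
proof (rule has_fps_expansionI)
  have "eventually (\<lambda>z. z \<in> ball 0 1) (nhds (0 :: complex))" by (intro eventually_nhds_in_open) auto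
  then show "\<forall>\<^sub>F z in nhds 0. (\<lambda>n. Abs_fps (\<lambda>n. - ((- 1) ^ n) / of_nat n) $ n * z ^ n) sums Ln (1 + z)"
  proof eventually_elim
    case (elim z)
    then show ?case using Ln_series'[of z] by (simp add: power_minus')
  qed
qed

lemma has_fps_expansion_Ln_1_minus: "(\<lambda>z. Ln (1 - z)) has_fps_expansion Abs_fps (\<lambda>n. - 1 / of_nat n)"
proof (rule has_fps_expansionI)
  have "eventually (\<lambda>z. z \<in> ball 0 1) (nhds (0 :: complex))" by (intro eventually_nhds_in_open) auto
  then show "\<forall>\<^sub>F z in nhds 0. (\<lambda>n. Abs_fps (\<lambda>n. - 1 / of_nat n) $ n * z ^ n) sums Ln (1 - z)"
  proof eventually_elim
    case (elim z)
    then show ?case using Ln_series'[of "- z"] by simp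
  qed
qed

text \<open>
  Multiplying the Mercator series of \<open>Ln (1 + z)\<close> and \<open>Ln (1 - z)\<close> by \<open>(1 + z)\<^sup>2\<close> and \<open>(1 - z)\<^sup>2\<close> takes second
  differences of \<open>1 / n\<close>, which are \<open>2 / (n * (n - 1) * (n - 2))\<close>, and in the sum the odd coefficients cancel.
  The two series have the harmless term \<open>1 / 0 = 0\<close> at \<open>n = 0\<close>.
\<close>
lemma has_fps_expansion_log_transform: "log_transform has_fps_expansion log_transform_fps"
proof -
  define P where "P = Abs_fps (\<lambda>n. - ((- 1) ^ n) / of_nat n :: complex)"
  define M where "M = Abs_fps (\<lambda>n. - 1 / of_nat n :: complex)"
  define F where "F = 3 * fps_X ^ 2 - ((1 + fps_X) ^ 2 * P + (1 - fps_X) ^ 2 * M)"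
  have F: "(\<lambda>z. 3 * z ^ 2 - ((1 + z) ^ 2 * Ln (1 + z) + (1 - z) ^ 2 * Ln (1 - z))) has_fps_expansion F"
    unfolding F_def P_def M_def power2_eq_square
    by (intro fps_expansion_intros has_fps_expansion_Ln_1_plus has_fps_expansion_Ln_1_minus)
  have F': "F = 3 * fps_X ^ 2 - (P + fps_X * P + fps_X * P + fps_X * (fps_X * P) + (M - fps_X * M - fps_X * M + fps_X * (fps_X * M)))"
    by (simp add: F_def power2_eq_square algebra_simps)
  have nth: "F $ n = (if n < 3 then 0 else 2 * of_real (triangular_moment (n - 2) / real (n - 2)))" for n
  proof -
    consider "n = 0" | "n = 1" | "n = 2" | "n \<ge> 3" by linarith
    then show ?thesis
    proof cases
      case 4
      then obtain k where n: "n = k + 3" using le_Suc_ex by (metis add.commute)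
      have "(of_nat k + 1 :: complex) \<noteq> 0" "(of_nat k + 2 :: complex) \<noteq> 0" "(of_nat k + 3 :: complex) \<noteq> 0"
        by (metis of_nat_1 of_nat_add of_nat_eq_0_iff of_nat_numeral add_is_0 zero_neq_one zero_neq_numeral)+
      then show ?thesis
        unfolding F' n
        by (cases "even k") (simp_all add: P_def M_def triangular_moment_def fps_X_power_nth numeral_fps_const divide_simps, simp_all add: algebra_simps)
    qed (simp_all add: F' P_def M_def fps_X_power_nth numeral_fps_const)
  qed
  have "F $ 4 \<noteq> 0" unfolding nth by (simp add: triangular_moment_def)
  then have "F \<noteq> 0" by (metis fps_zero_nth)
  then have "2 \<le> subdegree F" by (intro subdegree_geI) (auto simp: nth)
  from has_fps_expansion_shift[OF F this refl]
  have "(\<lambda>z. 1 / 2 * (if z = 0 then F $ 2 else (3 * z ^ 2 - ((1 + z) ^ 2 * Ln (1 + z) + (1 - z) ^ 2 * Ln (1 - z))) / z ^ 2))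
      has_fps_expansion fps_const (1 / 2) * fps_shift 2 F"
    by (rule has_fps_expansion_cmult_left)
  also have "(\<lambda>z. 1 / 2 * (if z = 0 then F $ 2 else (3 * z ^ 2 - ((1 + z) ^ 2 * Ln (1 + z) + (1 - z) ^ 2 * Ln (1 - z))) / z ^ 2)) = log_transform"
    by (rule ext) (auto simp: log_transform_def nth field_simps)
  also have "fps_const (1 / 2) * fps_shift 2 F = log_transform_fps"
    by (rule fps_ext) (auto simp: log_transform_fps_def nth)
  finally show ?thesis .
qed

text \<open>
  Differentiating \<open>exp \<circ> log_transform\<close> yields the recursion of \<open>limit_moment\<close>.
\<close>
lemma exp_log_transform_fps_nth:
  "(fps_exp 1 oo log_transform_fps) $ k = of_real (limit_moment triangular_moment k)"
proof (induction k rule: less_induct)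
  case (less k)
  show ?case
  proof (cases k)
    case 0
    then show ?thesis by simp
  next
    case (Suc n)
    let ?X = "fps_exp 1 oo log_transform_fps"
    have "fps_deriv ?X = fps_deriv log_transform_fps * ?X"
      by (subst fps_compose_deriv) (simp_all add: log_transform_fps_def mult.commute)
    then have "fps_deriv ?X $ n = (fps_deriv log_transform_fps * ?X) $ n" by simp
    then have "of_nat (Suc n) * ?X $ Suc n = (\<Sum>i=0..n. (of_nat (Suc i) * log_transform_fps $ Suc i) * ?X $ (n - i))"
      by (simp only: fps_deriv_nth fps_mult_nth Suc_eq_plus1)
    also have "\<dots> = (\<Sum>i=0..n. of_real (triangular_moment (Suc i) * limit_moment triangular_moment (n - i)))"
    proof (rule sum.cong[OF refl])
      fix i assume "i \<in> {0..n}"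
      then have "?X $ (n - i) = of_real (limit_moment triangular_moment (n - i))" using less Suc by simp
      moreover have "of_nat (Suc i) * log_transform_fps $ Suc i = of_real (triangular_moment (Suc i))"
        by (simp add: log_transform_fps_def del: of_nat_Suc)
      ultimately show "(of_nat (Suc i) * log_transform_fps $ Suc i) * ?X $ (n - i) =
          of_real (triangular_moment (Suc i) * limit_moment triangular_moment (n - i))" by simp
    qed
    also have "\<dots> = of_nat (Suc n) * of_real (limit_moment triangular_moment (Suc n))"
      by (simp add: atMost_atLeast0 del: of_nat_Suc)
    finally show ?thesis unfolding Suc by (simp del: of_nat_Suc limit_moment.simps)
  qed
qed

lemma has_fps_expansion_remainder:
  fixes f :: "complex \<Rightarrow> complex"
  assumes "f has_fps_expansion F"
  shows "\<exists>C \<rho>. \<rho> > 0 \<and> (\<forall>z. norm z \<le> \<rho> \<longrightarrow> norm (f z - (\<Sum>m<n. F $ m * z ^ m)) \<le> C * norm z ^ n)"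
proof -
  from assms obtain s where s: "open s" "0 \<in> s" "\<And>z. z \<in> s \<Longrightarrow> eval_fps F z = f z" and r: "fps_conv_radius F > 0"
    by (auto simp: has_fps_expansion_def eventually_nhds)
  have r': "fps_conv_radius (fps_shift n F) > 0" using r by simp
  have "isCont (eval_fps (fps_shift n F)) 0" using r' by (intro continuous_eval_fps continuous_ident) (simp add: zero_ereal_def)
  then have "\<forall>\<^sub>F z in nhds 0. dist (eval_fps (fps_shift n F) z) (eval_fps (fps_shift n F) 0) < 1"
    using tendstoD[of "eval_fps (fps_shift n F)" "eval_fps (fps_shift n F) 0" "nhds 0" 1]
    by (simp add: isCont_def tendsto_at_iff_tendsto_nhds)
  moreover have "\<forall>\<^sub>F z in nhds 0. z \<in> s" using s by (intro eventually_nhds_in_open)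
  moreover have "\<forall>\<^sub>F z in nhds 0. z \<in> eball 0 (fps_conv_radius F)"
    using r by (intro eventually_nhds_in_open) (auto simp: zero_ereal_def)
  ultimately have "\<forall>\<^sub>F z in nhds 0. norm (f z - (\<Sum>m<n. F $ m * z ^ m)) \<le> (norm (eval_fps (fps_shift n F) 0) + 1) * norm z ^ n"
  proof eventually_elim
    case (elim z)
    have "norm z < fps_conv_radius F" using elim by (simp add: eball_def dist_norm)
    then have sums: "(\<lambda>m. F $ m * z ^ m) sums eval_fps F z" by (rule sums_eval_fps)
    have "(\<lambda>m. F $ (m + n) * z ^ (m + n)) sums (eval_fps F z - (\<Sum>m<n. F $ m * z ^ m))"
      using sums_split_initial_segment[OF sums] by simp
    moreover have "(\<lambda>m. z ^ n * (fps_shift n F $ m * z ^ m)) sums (z ^ n * eval_fps (fps_shift n F) z)"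
      using \<open>norm z < fps_conv_radius F\<close> by (intro sums_mult sums_eval_fps) simp
    moreover have "(\<lambda>m. z ^ n * (fps_shift n F $ m * z ^ m)) = (\<lambda>m. F $ (m + n) * z ^ (m + n))"
      by (simp add: power_add mult_ac)
    ultimately have "f z - (\<Sum>m<n. F $ m * z ^ m) = z ^ n * eval_fps (fps_shift n F) z"
      using sums_unique2 s(3) elim by metis
    moreover have "norm (eval_fps (fps_shift n F) z) \<le> norm (eval_fps (fps_shift n F) 0) + 1"
      using elim norm_triangle_sub[of "eval_fps (fps_shift n F) z" "eval_fps (fps_shift n F) 0"] unfolding dist_norm by linarith
    ultimately show ?case by (simp add: norm_mult norm_power mult.commute mult_left_mono)
  qed
  then obtain e where e: "e > 0" "\<And>z. dist z 0 < e \<Longrightarrow>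
      norm (f z - (\<Sum>m<n. F $ m * z ^ m)) \<le> (norm (eval_fps (fps_shift n F) 0) + 1) * norm z ^ n"
    unfolding eventually_nhds_metric by blast
  show ?thesis
    by (intro exI[of _ "norm (eval_fps (fps_shift n F) 0) + 1"] exI[of _ "e / 2"]) (use e in auto)
qed

text \<open>
  The integral of \<open>D\<close> over the boundary of a half disc of radius \<open>R\<close> vanishes. On the arc \<open>D w\<close> is
  \<open>c / w\<close> up to \<open>C / R\<^sup>2\<close>, and the arc integral of \<open>c / w\<close> is \<open>\<i> * pi * c\<close>.
\<close>
lemma integral_real_line_of_decay:
  fixes D :: "complex \<Rightarrow> complex"
  assumes cont: "continuous_on {w. Im w \<ge> 0} D"
    and holo: "\<And>w. Im w > 0 \<Longrightarrow> D field_differentiable at w"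
    and decay: "\<And>w. Im w \<ge> 0 \<Longrightarrow> norm w \<ge> R0 \<Longrightarrow> norm (D w - c / w) \<le> C / norm w ^ 2"
    and R: "R \<ge> R0" "R > 0"
  shows "norm (integral {- R..R} (\<lambda>t. D (of_real t)) + \<i> * of_real pi * c) \<le> C * pi / R"
proof -
  let ?arc = "part_circlepath 0 R 0 pi"
  let ?line = "linepath (- of_real R) (of_real R :: complex)"
  let ?H = "{w. Im w \<ge> 0}"
  have "convex ?H" by (rule convex_halfspace_Im_ge)
  have line: "path_image ?line \<subseteq> ?H"
    unfolding path_image_linepath by (rule closed_segment_subset[OF _ _ \<open>convex ?H\<close>]) simp_all
  have arc: "path_image ?arc \<subseteq> ?H"
    using R by (auto simp: path_image_part_circlepath' closed_segment_eq_real_ivl intro!: mult_nonneg_nonneg sin_ge_zero)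
  have zero: "(D has_contour_integral 0) (?line +++ ?arc)"
  proof (rule Cauchy_theorem_convex[OF cont \<open>convex ?H\<close> finite.emptyI])
    show "D field_differentiable at w" if "w \<in> interior ?H - {}" for w
    proof -
      have "interior ?H = {w. Im w > 0}"
        using interior_halfspace_ge[of \<i> 0] by (simp add: inner_complex_def)
      then show ?thesis using that holo by simp
    qed
    show "valid_path (?line +++ ?arc)" by (intro valid_path_join) auto
    show "path_image (?line +++ ?arc) \<subseteq> ?H" by (rule subset_path_image_join[OF line arc])
    show "pathfinish (?line +++ ?arc) = pathstart (?line +++ ?arc)" by simp
  qed
  have "D contour_integrable_on ?line" "D contour_integrable_on ?arc"
    using contour_integrable_join[of ?line ?arc D] has_contour_integral_integrable[OF zero] by simp_all
  then obtain I J where I: "(D has_contour_integral I) ?line" and J: "(D has_contour_integral J) ?arc"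
    by (auto simp: contour_integrable_on_def)
  have "(D has_contour_integral (I + J)) (?line +++ ?arc)"
    by (rule has_contour_integral_join[OF I J]) simp_all
  from contour_integral_unique[OF this] contour_integral_unique[OF zero] have "I + J = 0" by simp
  have "((\<lambda>t. D (of_real t)) has_integral I) {- R..R}"
    using I R by (subst (asm) has_contour_integral_linepath_Reals_iff) auto
  then have I': "integral {- R..R} (\<lambda>t. D (of_real t)) = I" by (rule integral_unique)
  have J': "((\<lambda>t. D (of_real R * cis t) * of_real R * \<i> * cis t) has_integral J) {0..pi}"
    using J by (simp add: has_contour_integral_part_circlepath_iff)
  have "((\<lambda>t. D (of_real R * cis t) * of_real R * \<i> * cis t - \<i> * c) has_integral (J - pi *\<^sub>R (\<i> * c))) {0..pi}"
    using has_integral_diff[OF J' has_integral_const_real[of "\<i> * c" 0 pi]] by simp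
  then have "norm (J - pi *\<^sub>R (\<i> * c)) \<le> C / R * measure lborel {0..pi}"
  proof (rule has_integral_bound_real[where S = "{}", rotated 2])
    have "norm (D (of_real R) - c / of_real R) \<le> C / R ^ 2"
      using decay[of "of_real R"] R by simp
    then have "0 \<le> C / R ^ 2" using norm_ge_zero order_trans by blast
    then show "0 \<le> C / R" using R by (simp add: zero_le_divide_iff)
    fix t assume t: "t \<in> {0..pi} - {}"
    let ?w = "of_real R * cis t"
    have w: "norm ?w = R" "?w \<noteq> 0" "Im ?w \<ge> 0" using R t by (auto simp: norm_mult sin_ge_zero)
    \<comment> \<open>the integrand of the arc, parametrised by the angle, minus that of \<open>c / w\<close>\<close>
    have "D ?w * of_real R * \<i> * cis t - \<i> * c = \<i> * ?w * (D ?w - c / ?w)"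
      using w(2) by (simp add: algebra_simps)
    then have "norm (D ?w * of_real R * \<i> * cis t - \<i> * c) = R * norm (D ?w - c / ?w)"
      using w(1) by (simp only: norm_mult) (simp add: R less_imp_le)
    also have "\<dots> \<le> R * (C / R ^ 2)" using decay[of ?w] w R by (intro mult_left_mono) auto
    also have "\<dots> = C / R" using R by (simp add: power2_eq_square)
    finally show "norm (D ?w * of_real R * \<i> * cis t - \<i> * c) \<le> C / R" .
  qed auto
  moreover have "integral {- R..R} (\<lambda>t. D (of_real t)) + \<i> * of_real pi * c = - (J - pi *\<^sub>R (\<i> * c))"
  proof -
    have "I = - J" using \<open>I + J = 0\<close> by (simp add: eq_neg_iff_add_eq_0)
    then show ?thesis unfolding I' by (simp add: scaleR_conv_of_real mult_ac)
  qed
  ultimately show ?thesis by (simp only: norm_minus_cancel) simp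
qed

text \<open>
  Subtracting the polynomial part of \<open>w ^ k * stieltjes w\<close> at infinity leaves the next coefficient
  of the expansion as leading term.
\<close>
lemma stieltjes_moment_expansion:
  "\<exists>C R0. \<forall>w. Im w \<ge> 0 \<longrightarrow> norm w \<ge> R0 \<longrightarrow>
    norm ((w ^ k * stieltjes w - (\<Sum>m<k. of_real (limit_moment triangular_moment m) * w ^ (k - 1 - m)))
      - of_real (limit_moment triangular_moment k) / w) \<le> C / norm w ^ 2"
proof -
  let ?m = "\<lambda>k. of_real (limit_moment triangular_moment k) :: complex"
  have "(exp \<circ> log_transform) has_fps_expansion (fps_exp 1 oo log_transform_fps)"
    by (intro has_fps_expansion_compose has_fps_expansion_exp1 has_fps_expansion_log_transform)
       (simp add: log_transform_fps_def)
  from has_fps_expansion_remainder[OF this, of "Suc k"]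
  obtain C \<rho> where \<rho>: "\<rho> > 0"
    and C: "\<And>z. norm z \<le> \<rho> \<Longrightarrow> norm (exp (log_transform z) - (\<Sum>m<Suc k. ?m m * z ^ m)) \<le> C * norm z ^ Suc k"
    by (auto simp: exp_log_transform_fps_nth simp del: sum.lessThan_Suc)
  have "norm ((w ^ k * stieltjes w - (\<Sum>m<k. ?m m * w ^ (k - 1 - m))) - ?m k / w) \<le> C / norm w ^ 2"
    if w: "Im w \<ge> 0" "norm w \<ge> max 2 (1 / \<rho>)" for w
  proof -
    have w0: "w \<noteq> 0" "norm w > 1" using w(2) by auto
    have "norm (1 / w) \<le> \<rho>" using w(2) \<rho> w0 by (simp add: norm_divide field_simps)
    from C[OF this] have le: "norm (w * stieltjes w - (\<Sum>m<Suc k. ?m m * (1 / w) ^ m)) \<le> C * norm (1 / w) ^ Suc k"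
      using stieltjes_at_infinity[OF w(1) w0(2)] by simp
    have "w ^ k * (\<Sum>m<k. ?m m * (1 / w) ^ m) = w * (\<Sum>m<k. ?m m * w ^ (k - 1 - m))"
      unfolding sum_distrib_left
    proof (rule sum.cong[OF refl])
      fix m assume "m \<in> {..<k}"
      then have "w ^ k = w * w ^ (k - 1 - m) * w ^ m"
        by (simp flip: power_add power_Suc)
      then show "w ^ k * (?m m * (1 / w) ^ m) = w * (?m m * w ^ (k - 1 - m))"
        using w0 by (simp add: power_divide)
    qed
    then have "w ^ k * (w * stieltjes w - (\<Sum>m<Suc k. ?m m * (1 / w) ^ m)) =
        w * ((w ^ k * stieltjes w - (\<Sum>m<k. ?m m * w ^ (k - 1 - m))) - ?m k / w)"
      using w0 by (simp add: algebra_simps power_divide)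
    from arg_cong[OF this, of norm] have "norm w * norm ((w ^ k * stieltjes w - (\<Sum>m<k. ?m m * w ^ (k - 1 - m))) - ?m k / w) =
        norm w ^ k * norm (w * stieltjes w - (\<Sum>m<Suc k. ?m m * (1 / w) ^ m))"
      by (simp only: norm_mult norm_power)
    also have "\<dots> \<le> norm w ^ k * (C * norm (1 / w) ^ Suc k)" by (intro mult_left_mono le) simp
    also have "\<dots> = C / norm w" using w0 by (simp add: norm_divide power_divide)
    finally show ?thesis using w0 by (simp add: field_simps power2_eq_square)
  qed
  then show ?thesis by blast
qed

text \<open>
  The subtracted polynomial has real coefficients and is invisible in the imaginary part on
  the real line, so \<open>integral_real_line_of_decay\<close> computes the integral of the imaginary part of
  \<open>t ^ k * stieltjes t\<close> in the limit of large \<open>R\<close>. Outside \<open>[-1, 1]\<close> the integrand vanishes, so the integral does not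
  depend on \<open>R\<close>.
\<close>
lemma has_integral_limit_moment:
  assumes supp: "\<And>t. \<bar>t\<bar> > 1 \<Longrightarrow> Im (stieltjes (of_real t)) = 0"
  shows "((\<lambda>t. t ^ k * (- Im (stieltjes (of_real t)) / pi)) has_integral limit_moment triangular_moment k) {- 1..1}"
proof -
  let ?m = "limit_moment triangular_moment"
  define q where "q w = (\<Sum>m<k. of_real (?m m) * w ^ (k - 1 - m))" for w :: complex
  define D where "D w = w ^ k * stieltjes w - q w" for w
  obtain C R0 where C: "\<And>w. Im w \<ge> 0 \<Longrightarrow> norm w \<ge> R0 \<Longrightarrow> norm (D w - of_real (?m k) / w) \<le> C / norm w ^ 2"
    using stieltjes_moment_expansion[of k] unfolding D_def q_def by blast
  have cont: "continuous_on {w. Im w \<ge> 0} D"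
    unfolding D_def q_def by (intro continuous_intros continuous_on_stieltjes)
  have holo: "D field_differentiable at w" if "Im w > 0" for w
  proof -
    have "q field_differentiable at w"
      unfolding q_def by (intro derivative_intros field_differentiable_sum field_differentiable_mult
          field_differentiable_power)
    then show ?thesis
      unfolding D_def using stieltjes_field_differentiable[OF that]
      by (intro field_differentiable_diff field_differentiable_mult field_differentiable_power
          field_differentiable_ident)
  qed
  define p where "p t = t ^ k * (- Im (stieltjes (of_real t)) / pi)" for t :: real
  have p: "Im (D (of_real t)) = - pi * p t" for t
  proof -
    have "Im (q (of_real t)) = 0"
      by (simp add: q_def Im_sum flip: of_real_power)
    then show ?thesis by (simp add: D_def p_def flip: of_real_power)
  qed
  have contR: "continuous_on A (\<lambda>t. D (of_real t))" for A :: "real set"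
    by (rule continuous_on_compose2[OF cont]) (auto intro!: continuous_intros)
  have contp: "continuous_on A p" for A
  proof -
    have "continuous_on A (\<lambda>t. - Im (D (of_real t)) / pi)"
      by (intro continuous_intros contR) simp
    then show ?thesis by (simp add: p)
  qed
  have int: "\<bar>integral {- 1..1} p - ?m k\<bar> \<le> C / R" if R: "R \<ge> max R0 1" for R
  proof -
    have "norm (integral {- R..R} (\<lambda>t. D (of_real t)) + \<i> * of_real pi * of_real (?m k)) \<le> C * pi / R"
      by (rule integral_real_line_of_decay[OF cont holo C]) (use R in auto)
    then have "\<bar>Im (integral {- R..R} (\<lambda>t. D (of_real t)) + \<i> * of_real pi * of_real (?m k))\<bar> \<le> C * pi / R"
      using abs_Im_le_cmod order_trans by blast
    moreover have "Im (integral {- R..R} (\<lambda>t. D (of_real t))) = integral {- R..R} (\<lambda>t. - pi * p t)"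
    proof -
      have "((\<lambda>t. D (of_real t)) has_integral integral {- R..R} (\<lambda>t. D (of_real t))) {- R..R}"
        by (intro integrable_integral integrable_continuous_interval contR)
      from has_integral_Im[OF this] show ?thesis unfolding p by (rule integral_unique[symmetric])
    qed
    moreover have "integral {- R..R} (\<lambda>t. - pi * p t) = - pi * integral {- 1..1} p"
    proof -
      have "(p has_integral integral {- 1..1} p) {- 1..1}"
        by (intro integrable_integral integrable_continuous_interval contp)
      then have "(p has_integral integral {- 1..1} p) {- R..R}"
        by (rule has_integral_on_superset) (use R supp in \<open>auto simp: p_def\<close>)
      from has_integral_mult_right[OF this, of "- pi"] show ?thesis by (rule integral_unique)
    qed
    ultimately have "\<bar>pi * (?m k - integral {- 1..1} p)\<bar> \<le> C * pi / R" by (simp add: algebra_simps)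
    then have "pi * \<bar>integral {- 1..1} p - ?m k\<bar> \<le> pi * (C / R)" by (simp add: abs_mult abs_minus_commute mult.commute)
    then show ?thesis by (simp only: mult_le_cancel_left_pos[OF pi_gt_zero])
  qed
  have "((\<lambda>R. C / R) \<longlongrightarrow> 0) at_top" by (rule tendsto_divide_0[OF tendsto_const filterlim_at_top_imp_at_infinity[OF filterlim_ident]])
  then have "\<bar>integral {- 1..1} p - ?m k\<bar> \<le> 0"
    by (rule tendsto_lowerbound) (use int in \<open>auto simp: eventually_at_top_linorder intro!: exI[of _ "max R0 1"]\<close>)
  then have "integral {- 1..1} p = ?m k" by simp
  moreover have "(p has_integral integral {- 1..1} p) {- 1..1}"
    by (intro integrable_integral integrable_continuous_interval contp)
  ultimately show ?thesis unfolding p_def by simp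
qed

section \<open>The limit density and convergence in law\<close>

lemma density_factor_eq_exp:
  assumes "0 < s" "s < 1"
  shows "exp (3 / 2) / (pi * s) * (1 / s - 1) powr (- (1 / 2) * (1 - s)\<^sup>2) * (1 / s + 1) powr (- (1 / 2) * (1 + s)\<^sup>2)
    = exp (3 / 2 - (1 + s) ^ 2 * ln (1 + s) / 2 - (1 - s) ^ 2 * ln (1 - s) / 2 + s ^ 2 * ln s) / pi"
proof -
  have "1 / s - 1 = (1 - s) / s" "1 / s + 1 = (1 + s) / s" using assms by (simp_all add: field_simps)
  then have powr: "(1 / s - 1) powr a = exp (a * (ln (1 - s) - ln s))"
    "(1 / s + 1) powr a = exp (a * (ln (1 + s) - ln s))" for a
    using assms by (simp_all add: powr_def ln_div)
  have "1 / s = exp (- ln s)" using assms by (simp add: exp_minus inverse_eq_divide)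
  then have "exp (3 / 2) / (pi * s) = exp (3 / 2) * exp (- ln s) / pi"
    by (metis (no_types, opaque_lifting) divide_divide_eq_left mult.commute mult.right_neutral times_divide_eq_right)
  then have "exp (3 / 2) / (pi * s) * (1 / s - 1) powr (- (1 / 2) * (1 - s)\<^sup>2) * (1 / s + 1) powr (- (1 / 2) * (1 + s)\<^sup>2)
      = exp (3 / 2 + - ln s + - (1 / 2) * (1 - s)\<^sup>2 * (ln (1 - s) - ln s) + - (1 / 2) * (1 + s)\<^sup>2 * (ln (1 + s) - ln s)) / pi"
    unfolding powr exp_add by simp
  also have "3 / 2 + - ln s + - (1 / 2) * (1 - s)\<^sup>2 * (ln (1 - s) - ln s) + - (1 / 2) * (1 + s)\<^sup>2 * (ln (1 + s) - ln s)
      = 3 / 2 - (1 + s) ^ 2 * ln (1 + s) / 2 - (1 - s) ^ 2 * ln (1 - s) / 2 + s ^ 2 * ln s"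
    by (simp add: power2_eq_square field_simps)
  finally show ?thesis .
qed

text \<open>
  For \<open>0 < t < 1\<close> only \<open>t - 1\<close> is negative, and the phase is \<open>- pi / 2 * (1 - t)\<^sup>2\<close>. For \<open>-1 < t < 0\<close> both
  \<open>t\<close> and \<open>t - 1\<close> are negative, and the phase is the mirror image \<open>pi / 2 * (1 + t)\<^sup>2 - pi\<close>. Outside
  \<open>[-1, 1]\<close> the phase is 0 or \<open>- pi\<close>.
\<close>
lemma Y2_limit_density_eq: "Y2_limit_density t = - Im (stieltjes (of_real t)) / pi"
proof -
  define A where "A = 3 / 2 - (t + 1) ^ 2 * ln \<bar>t + 1\<bar> / 2 - (t - 1) ^ 2 * ln \<bar>t - 1\<bar> / 2 + t ^ 2 * ln \<bar>t\<bar>"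
  define B where "B = - pi / 2 * (of_bool (t < - 1) * (t + 1) ^ 2 + of_bool (t < 1) * (t - 1) ^ 2) + pi * of_bool (t < 0) * t ^ 2"
  have Im: "Im (stieltjes (of_real t)) = exp A * sin B"
    unfolding A_def B_def by (rule Im_stieltjes_of_real)
  consider "t \<ge> 1" | "t = 0" | "t < - 1" | "t = - 1" | "0 < \<bar>t\<bar>" "\<bar>t\<bar> < 1" by linarith
  then show ?thesis
  proof cases
    case 1
    then have "B = 0" by (simp add: B_def)
    then show ?thesis unfolding Im Y2_limit_density_def using 1 by auto
  next
    case 2
    then have A: "A = 3 / 2" and B: "B = - (pi / 2)" by (simp_all add: A_def B_def)
    show ?thesis unfolding Im A B Y2_limit_density_def using 2 by simp
  next
    case 3
    then have "B = - pi" by (simp add: B_def power2_eq_square field_simps)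
    then show ?thesis unfolding Im Y2_limit_density_def using 3 by simp
  next
    case 4
    then have "B = - pi" by (simp add: B_def)
    then show ?thesis unfolding Im Y2_limit_density_def using 4 by simp
  next
    case 5
    define s where "s = \<bar>t\<bar>"
    have s: "0 < s" "s < 1" and "t \<noteq> 0" using 5 by (auto simp: s_def)
    have "A = 3 / 2 - (1 + s) ^ 2 * ln (1 + s) / 2 - (1 - s) ^ 2 * ln (1 - s) / 2 + s ^ 2 * ln s"
    proof (cases "t > 0")
      case True
      then have "t = s" by (simp add: s_def)
      then show ?thesis using s by (simp add: A_def power2_commute add.commute)
    next
      case False
      then have "t = - s" by (simp add: s_def)
      then show ?thesis using s by (simp add: A_def power2_eq_square algebra_simps)
    qed
    moreover have "sin B = - sin ((1 - s)\<^sup>2 / 2 * pi)"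
    proof (cases "t > 0")
      case True
      then have "t = s" by (simp add: s_def)
      then have "B = - ((1 - s)\<^sup>2 / 2 * pi)" using s by (simp add: B_def power2_commute)
      then show ?thesis by simp
    next
      case False
      then have "t = - s" by (simp add: s_def)
      then have "B = (1 - s)\<^sup>2 / 2 * pi - pi" using s by (simp add: B_def power2_eq_square field_simps)
      then show ?thesis by (simp add: sin_diff)
    qed
    ultimately show ?thesis
      using s \<open>t \<noteq> 0\<close> density_factor_eq_exp[OF s] unfolding Im Y2_limit_density_def s_def[symmetric] by simp
  qed
qed

lemma continuous_on_Y2_limit_density: "continuous_on A Y2_limit_density"
proof -
  have "continuous_on A (\<lambda>t. stieltjes (of_real t))"
    by (rule continuous_on_compose2[OF continuous_on_stieltjes]) (auto intro!: continuous_intros)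
  then have "continuous_on A (\<lambda>t. - Im (stieltjes (of_real t)) / pi)"
    by (intro continuous_intros) auto
  then show ?thesis by (simp add: Y2_limit_density_eq[abs_def])
qed

lemma Y2_limit_density_nonneg: "Y2_limit_density t \<ge> 0"
proof (cases "\<bar>t\<bar> > 1 \<or> t = 0")
  case True
  then show ?thesis by (auto simp: Y2_limit_density_def)
next
  case False
  then have "(1 - \<bar>t\<bar>)\<^sup>2 \<le> 1" by (simp add: abs_square_le_1)
  then have "(1 - \<bar>t\<bar>)\<^sup>2 / 2 * pi \<le> 1 * pi" by (intro mult_right_mono) auto
  then have "sin ((1 - \<bar>t\<bar>)\<^sup>2 / 2 * pi) \<ge> 0" by (intro sin_ge_zero) auto
  then show ?thesis using False by (auto simp: Y2_limit_density_def intro!: mult_nonneg_nonneg)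
qed

lemma Y2_limit_density_moment:
  shows "integrable lborel (\<lambda>t. Y2_limit_density t * t ^ k)"
    and "integral\<^sup>L lborel (\<lambda>t. Y2_limit_density t * t ^ k) = limit_moment triangular_moment k"
proof -
  have supp: "Y2_limit_density t = 0" if "\<bar>t\<bar> > 1" for t using that by (simp add: Y2_limit_density_def)
  have ind: "(\<lambda>t. indicator {- 1..1} t *\<^sub>R (Y2_limit_density t * t ^ k)) = (\<lambda>t. Y2_limit_density t * t ^ k)"
    using supp by (auto simp: indicator_def fun_eq_iff abs_if split: if_splits)
  have int: "set_integrable lborel {- 1..1} (\<lambda>t. Y2_limit_density t * t ^ k)"
    by (intro borel_integrable_atLeastAtMost' continuous_intros continuous_on_Y2_limit_density)
  then show "integrable lborel (\<lambda>t. Y2_limit_density t * t ^ k)"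
    by (simp only: set_integrable_def ind)
  have "Im (stieltjes (of_real t)) = 0" if "\<bar>t\<bar> > 1" for t
    using Y2_limit_density_eq[of t] supp[OF that] by simp
  from has_integral_limit_moment[OF this]
  have "((\<lambda>t. Y2_limit_density t * t ^ k) has_integral limit_moment triangular_moment k) {- 1..1}"
    by (simp add: Y2_limit_density_eq mult.commute)
  then show "integral\<^sup>L lborel (\<lambda>t. Y2_limit_density t * t ^ k) = limit_moment triangular_moment k"
    using set_borel_integral_eq_integral(2)[OF int] by (simp add: set_lebesgue_integral_def ind[unfolded real_scaleR_def] integral_unique)
qed

lemma borel_measurable_Y2_limit_density [measurable]: "Y2_limit_density \<in> borel_measurable borel"
  by (intro borel_measurable_continuous_onI continuous_on_Y2_limit_density)

definition limit_law :: "real measure" where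
  "limit_law = density lborel (\<lambda>t. ennreal (Y2_limit_density t))"

lemma real_distribution_limit_law: "real_distribution limit_law"
proof -
  have "emeasure limit_law (space limit_law) = (\<integral>\<^sup>+t. ennreal (Y2_limit_density t) \<partial>lborel)"
    by (simp add: limit_law_def emeasure_density)
  also have "\<dots> = ennreal (integral\<^sup>L lborel Y2_limit_density)"
    using Y2_limit_density_moment(1)[of 0] by (intro nn_integral_eq_integral) (auto simp: Y2_limit_density_nonneg)
  also have "\<dots> = 1" using Y2_limit_density_moment(2)[of 0] by simp
  finally have "prob_space limit_law" by (rule prob_spaceI)
  then show ?thesis
    by (intro real_distribution.intro real_distribution_axioms.intro) (auto simp: limit_law_def)
qed

lemma limit_law_moment:
  shows "integrable limit_law (\<lambda>t. t ^ k)"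
    and "integral\<^sup>L limit_law (\<lambda>t. t ^ k) = limit_moment triangular_moment k"
  using Y2_limit_density_moment[of k] unfolding limit_law_def
  by (auto simp: integrable_density integral_density Y2_limit_density_nonneg)

lemma AE_limit_law: "AE t in limit_law. t \<in> {- 1..1}"
proof -
  have "AE t in lborel. 0 < ennreal (Y2_limit_density t) \<longrightarrow> t \<in> {- 1..1}"
    by (intro AE_I2) (auto simp: Y2_limit_density_def split: if_splits)
  then show ?thesis unfolding limit_law_def by (subst AE_density) auto
qed

lemma (in real_distribution) expectation_abs_power_le_1:
  assumes "AE x in M. x \<in> {- 1..1}"
  shows "expectation (\<lambda>x. \<bar>x\<bar> ^ k) \<le> 1"
proof -
  have "expectation (\<lambda>x. \<bar>x\<bar> ^ k) \<le> expectation (\<lambda>_. 1)"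
  proof (rule integral_mono_AE')
    show "AE x in M. \<bar>x\<bar> ^ k \<le> 1" using assms by eventually_elim (auto intro: power_le_one)
  qed auto
  then show ?thesis using prob_space by simp
qed

lemma (in real_distribution) integrable_power_bounded:
  assumes "AE x in M. x \<in> {- 1..1}"
  shows "integrable M (\<lambda>x. x ^ k)"
proof (rule integrable_const_bound[of _ 1])
  show "AE x in M. norm (x ^ k) \<le> 1" using assms by eventually_elim (auto simp: power_abs intro: power_le_one)
qed auto

text \<open>
  The Taylor polynomial of the exponential of degree \<open>K\<close> approximates all characteristic functions
  involved with the same error \<open>2 * \<bar>t\<bar> ^ K / fact K\<close>, as the absolute moments are at most 1.
\<close>
lemma char_tendsto_if_moments_tendsto:
  fixes M :: "nat \<Rightarrow> real measure"
  assumes M: "\<And>n. real_distribution (M n)" "real_distribution M'"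
    and supp: "\<And>n. AE x in M n. x \<in> {- 1..1}" "AE x in M'. x \<in> {- 1..1}"
    and moments: "\<And>k. (\<lambda>n. integral\<^sup>L (M n) (\<lambda>x. x ^ k)) \<longlonglongrightarrow> integral\<^sup>L M' (\<lambda>x. x ^ k)"
  shows "(\<lambda>n. char (M n) t) \<longlonglongrightarrow> char M' t"
proof (rule tendsto_if_approximable)
  fix \<eta> :: real assume "\<eta> > 0"
  have "(\<lambda>k. \<bar>t\<bar> ^ k /\<^sub>R fact k) \<longlonglongrightarrow> 0"
    using summable_LIMSEQ_zero[OF summable_exp_generic[of "\<bar>t\<bar>"]] .
  then have "(\<lambda>k. 2 * (\<bar>t\<bar> ^ k /\<^sub>R fact k)) \<longlonglongrightarrow> 0" by (rule tendsto_mult_right_zero)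
  then have "\<forall>\<^sub>F k in sequentially. 2 * (\<bar>t\<bar> ^ k /\<^sub>R fact k) < \<eta>"
    using \<open>\<eta> > 0\<close> by (rule order_tendstoD(2))
  then obtain K where K: "2 * (\<bar>t\<bar> ^ K /\<^sub>R fact K) < \<eta>" by (auto simp: eventually_sequentially)
  define T where "T L = (\<Sum>k\<le>K. ((\<i> * of_real t) ^ k / fact k) * of_real (integral\<^sup>L L (\<lambda>x. x ^ k)))" for L :: "real measure"
  have approx: "norm (char L t - T L) \<le> \<eta>" if "real_distribution L" "AE x in L. x \<in> {- 1..1}" for L
  proof -
    interpret real_distribution L by fact
    have "norm (char L t - T L) \<le> 2 * \<bar>t\<bar> ^ K / fact K * expectation (\<lambda>x. \<bar>x\<bar> ^ K)"
      unfolding T_def by (rule char_approx1) (rule integrable_power_bounded[OF that(2)])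
    also have "\<dots> \<le> 2 * \<bar>t\<bar> ^ K / fact K * 1"
      by (intro mult_left_mono expectation_abs_power_le_1 that(2)) auto
    finally show ?thesis using K by (simp add: divide_inverse mult_ac)
  qed
  have "(\<lambda>n. T (M n)) \<longlonglongrightarrow> T M'"
    unfolding T_def by (intro tendsto_intros moments)
  moreover have "norm (T M' - char M' t) \<le> \<eta>" using approx[OF M(2) supp(2)] by (simp add: norm_minus_commute)
  moreover have "\<forall>\<^sub>F n in sequentially. norm (char (M n) t - T (M n)) \<le> \<eta>"
    using approx[OF M(1) supp(1)] by simp
  ultimately show "\<exists>B c'. B \<longlonglongrightarrow> c' \<and> norm (c' - char M' t) \<le> \<eta> \<and> (\<forall>\<^sub>F n in sequentially. norm (char (M n) t - B n) \<le> \<eta>)"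
    by blast
qed

lemma Y2_eq_orbit_sum:
  assumes "\<sigma> permutes {1..n}"
  shows "Y2 \<alpha> \<beta> n \<sigma> = orbit_sum (\<lambda>j. frac (real j * \<alpha>) - frac (real j * \<beta>)) {1..n} \<sigma> / n"
  using sum_cycle_count_eq_orbit_sum[OF assms, of "\<lambda>j. frac (real j * \<alpha>) - frac (real j * \<beta>)"]
  by (simp add: Y2_def cycle_count_def flip: sum_divide_distrib)

lemma abs_frac_diff_le_1: "\<bar>frac x - frac y\<bar> \<le> (1 :: real)"
  using frac_ge_0[of x] frac_lt_1[of x] frac_ge_0[of y] frac_lt_1[of y] by linarith

lemma abs_Y2_le_1:
  assumes "\<sigma> permutes {1..n}"
  shows "\<bar>Y2 \<alpha> \<beta> n \<sigma>\<bar> \<le> 1"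
proof -
  have "\<bar>orbit_sum (\<lambda>j. frac (real j * \<alpha>) - frac (real j * \<beta>)) {1..n} \<sigma>\<bar> \<le> (\<Sum>e\<in>{1..n}. 1)"
    unfolding orbit_sum_def by (intro order.trans[OF sum_abs] sum_mono abs_frac_diff_le_1)
  then show ?thesis unfolding Y2_eq_orbit_sum[OF assms] by (cases "n = 0") (auto simp: abs_divide field_simps)
qed

lemma Y2_moment:
  "integral\<^sup>L (distr (measure_pmf (uniform_perm n)) borel (Y2 \<alpha> \<beta> n)) (\<lambda>x. x ^ k) =
     orbit_sum_moment (\<lambda>j. frac (real j * \<alpha>) - frac (real j * \<beta>)) k n / n ^ k"
proof -
  let ?u = "\<lambda>j. frac (real j * \<alpha>) - frac (real j * \<beta>)"
  let ?P = "{\<sigma>. \<sigma> permutes {1..n}}"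
  have P: "finite ?P" "?P \<noteq> {}" using finite_permutations[of "{1..n}"] permutes_id by blast+
  have "integral\<^sup>L (distr (measure_pmf (uniform_perm n)) borel (Y2 \<alpha> \<beta> n)) (\<lambda>x. x ^ k) =
      measure_pmf.expectation (uniform_perm n) (\<lambda>\<sigma>. Y2 \<alpha> \<beta> n \<sigma> ^ k)"
    by (subst integral_distr) auto
  also have "\<dots> = (\<Sum>\<sigma>\<in>?P. Y2 \<alpha> \<beta> n \<sigma> ^ k) / card ?P"
    unfolding uniform_perm_def by (rule integral_pmf_of_set[OF P(2,1)])
  also have "(\<Sum>\<sigma>\<in>?P. Y2 \<alpha> \<beta> n \<sigma> ^ k) = (\<Sum>\<sigma>\<in>?P. orbit_sum ?u {1..n} \<sigma> ^ k) / n ^ k"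
    by (simp add: Y2_eq_orbit_sum power_divide sum_divide_distrib)
  also have "(\<Sum>\<sigma>\<in>?P. orbit_sum ?u {1..n} \<sigma> ^ k) = fact n * orbit_sum_moment ?u k n"
    using sum_perms_orbit_sum_power[of "{1..n}" ?u k] by simp
  also have "card ?P = fact n" using card_permutations[of "{1..n}" n] by simp
  finally show ?thesis by simp
qed

lemma AE_distr_Y2: "AE x in distr (measure_pmf (uniform_perm n)) borel (Y2 \<alpha> \<beta> n). x \<in> {- 1..1}"
proof -
  have "finite {\<sigma>. \<sigma> permutes {1..n}}" "{\<sigma>. \<sigma> permutes {1..n}} \<noteq> {}"
    using finite_permutations[of "{1..n}"] permutes_id by blast+
  then have "AE \<sigma> in measure_pmf (uniform_perm n). Y2 \<alpha> \<beta> n \<sigma> \<in> {- 1..1}"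
    using abs_Y2_le_1 by (auto simp: AE_measure_pmf_iff uniform_perm_def abs_le_iff)
  then show ?thesis by (subst AE_distr_iff) auto
qed

theorem corollary1p1:
  fixes \<alpha> \<beta> :: real and N :: "'a measure" and Y :: "'a \<Rightarrow> real"
  assumes "\<alpha> < \<beta>"
    and "\<alpha> \<notin> \<rat>" and "\<beta> \<notin> \<rat>"
    and "rat_independent {1, \<alpha>, \<beta>}"
    and "prob_space N" and "Y \<in> borel_measurable N"
    and "weak_conv_m (\<lambda>n. distr (measure_pmf (uniform_perm n)) borel (Y2 \<alpha> \<beta> n)) (distr N borel Y)"
  shows "(AE \<omega> in N. Y \<omega> \<in> {-1..1})
    \<and> distributed N lborel Y (\<lambda>t. ennreal (Y2_limit_density t))
    \<and> isCont Y2_limit_density 0"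
proof -
  let ?u = "\<lambda>j. frac (real j * \<alpha>) - frac (real j * \<beta>)"
  let ?M = "\<lambda>n. distr (measure_pmf (uniform_perm n)) borel (Y2 \<alpha> \<beta> n)"
  have M: "real_distribution (?M n)" for n
    by (rule prob_space.real_distribution_distr) (auto intro: prob_space_measure_pmf)
  have L: "real_distribution (distr N borel Y)"
    using assms(5,6) by (rule prob_space.real_distribution_distr)
  have "\<alpha> \<noteq> 1" "\<beta> \<noteq> 1" "\<alpha> \<noteq> \<beta>" using assms(1-3) by auto
  note indep = rat_independent_int_combination[OF assms(4) this]
  have "(\<lambda>n. (\<Sum>j=1..n. ?u j ^ Suc i) / n) \<longlonglongrightarrow> triangular_moment (Suc i)" for i
    using has_mean_frac_difference_power[OF assms(2,3) indep, of "Suc i"]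
    by (simp only: has_mean_def triangular_moment_def)
  then have moments: "(\<lambda>n. integral\<^sup>L (?M n) (\<lambda>x. x ^ k)) \<longlonglongrightarrow> integral\<^sup>L limit_law (\<lambda>x. x ^ k)" for k
    unfolding Y2_moment limit_law_moment(2) by (rule orbit_sum_moment_tendsto) (rule abs_frac_diff_le_1)
  have "char (distr N borel Y) = char limit_law"
  proof
    fix t
    have "(\<lambda>n. char (?M n) t) \<longlonglongrightarrow> char limit_law t"
      by (rule char_tendsto_if_moments_tendsto[OF M real_distribution_limit_law AE_distr_Y2 AE_limit_law moments])
    moreover have "(\<lambda>n. char (?M n) t) \<longlonglongrightarrow> char (distr N borel Y) t"
      by (rule levy_continuity1[OF M L assms(7)])
    ultimately show "char (distr N borel Y) t = char limit_law t" by (intro LIMSEQ_unique)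
  qed
  then have law: "distr N borel Y = limit_law"
    by (rule Levy_uniqueness[OF L real_distribution_limit_law])
  have "AE \<omega> in N. Y \<omega> \<in> {- 1..1}"
    using AE_limit_law assms(6) unfolding law[symmetric] by (subst (asm) AE_distr_iff) auto
  moreover have "distributed N lborel Y (\<lambda>t. ennreal (Y2_limit_density t))"
    unfolding distributed_def
  proof (intro conjI)
    have "distr N lborel Y = distr N borel Y" by (rule distr_cong) auto
    then show "distr N lborel Y = density lborel (\<lambda>t. ennreal (Y2_limit_density t))"
      using law by (simp add: limit_law_def)
  qed (use assms(6) in auto)
  moreover have "isCont Y2_limit_density 0"
    using continuous_on_Y2_limit_density[of UNIV] by (simp add: continuous_on_eq_continuous_at)
  ultimately show ?thesis by blast
qed

end
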